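(* Let $m\ge1$ and let $\Lambda=(\lambda_1,\ldots,\lambda_n)\subset\mathbb{R}^{4m}$ be an admissible configuration whose affine span is $\mathbb{R}^{4m}$. Let $i:N_{\mathbb H}(\Lambda)\hookrightarrow\mathbb{H}P^{n-1}$ be the natural inclusion. Then the normal bundle of $N_{\mathbb H}(\Lambda)$ in $\mathbb{H}P^{n-1}$ is trivial and $$TN_{\mathbb H}(\Lambda)\oplus\mathbb{R}^{4m}\cong i^*T\mathbb{H}P^{n-1},$$ where $\mathbb{R}^{4m}$ denotes the trivial real vector bundle of rank $4m$.
   Context: $\mathbb{H}$ denotes the quaternions and $\operatorname{Sp}(1)$ the unit quaternions. A configuration $\Lambda=(\lambda_1,\ldots,\lambda_n)\subset\mathbb{R}^{4m}$ is admissible if $0\in\operatorname{conv}\{\lambda_1,\ldots,\lambda_n\}$ and, for every $I\subset\{1,\ldots,n\}$, $0\in\operatorname{conv}\{\lambda_i:i\in I\}$ implies $|I|>4m$. Define $$Z_{\mathbb H}(\Lambda)=\Big\{q\in\mathbb{H}^n:\ \sum_i\lambda_i|q_i|^2=0,\ \sum_i|q_i|^2=1\Big\},$$ on which $\operatorname{Sp}(1)$ acts freely by diagonal left multiplication $a\cdot(q_1,\ldots,q_n)=(aq_1,\ldots,aq_n)$, and $N_{\mathbb H}(\Lambda)=Z_{\mathbb H}(\Lambda)/\operatorname{Sp}(1)$. Quaternionic projective space is $\mathbb{H}P^{n-1}=(\mathbb{H}^n\setminus\{0\})/\mathbb{H}^*$ for left scalar multiplication, equivalently $\mathbb{S}^{4n-1}/\operatorname{Sp}(1)$;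 the natural inclusion $i$ is induced by $Z_{\mathbb H}(\Lambda)\subset\mathbb{S}^{4n-1}$. *)

theory Defs
  imports "HOL-Analysis.Analysis"
begin

section \<open>Quaternions\<close>

text \<open>A quaternion \<open>a + b i + c j + d k\<close> is the vector \<open>(a, b, c, d)\<close>, so that \<open>norm\<close> is the
  usual modulus and \<open>real^4^'n\<close> with its norm is \<open>\<H>\<^sup>n\<close> with \<open>|q|\<^sup>2 = \<Sum>i. |q\<^sub>i|\<^sup>2\<close>. The type class product
  of \<open>real^4\<close> is the componentwise one and is not used.\<close>

type_synonym quat = "real^4"

definition qmult :: "quat \<Rightarrow> quat \<Rightarrow> quat" (infixl "\<odot>" 70) where
  "p \<odot> q = vector
     [p$1 * q$1 - p$2 * q$2 - p$3 * q$3 - p$4 * q$4,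
      p$1 * q$2 + p$2 * q$1 + p$3 * q$4 - p$4 * q$3,
      p$1 * q$3 - p$2 * q$4 + p$3 * q$1 + p$4 * q$2,
      p$1 * q$4 + p$2 * q$3 - p$3 * q$2 + p$4 * q$1]"

lemma vector_4_nth [simp]:
  fixes a b c d :: "'a::zero"
  shows "(vector [a, b, c, d] :: 'a^4) $ 1 = a" "(vector [a, b, c, d] :: 'a^4) $ 2 = b"
        "(vector [a, b, c, d] :: 'a^4) $ 3 = c" "(vector [a, b, c, d] :: 'a^4) $ 4 = d"
  by (simp_all add: vector_def)

lemma qmult_assoc: "(p \<odot> q) \<odot> r = p \<odot> (q \<odot> r)"
  by (simp add: qmult_def vec_eq_iff forall_4 algebra_simps)

lemma norm_qmult: "norm (p \<odot> q) = norm p * norm q"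
proof -
  have "(norm (p \<odot> q))\<^sup>2 = (norm p * norm q)\<^sup>2"
    by (simp add: power_mult_distrib power2_norm_eq_inner inner_vec_def sum_4 qmult_def)
       (simp add: algebra_simps power2_eq_square)
  then show ?thesis by simp
qed

definition qscale :: "quat \<Rightarrow> quat^'n \<Rightarrow> quat^'n" where
  "qscale a q = (\<chi> i. a \<odot> q$i)"

definition Sp1_orbit :: "quat^'n \<Rightarrow> (quat^'n) set" where
  "Sp1_orbit q = {qscale a q | a. norm a = 1}"

definition Hstar_orbit :: "quat^'n \<Rightarrow> (quat^'n) set" where
  "Hstar_orbit q = {qscale a q | a. a \<noteq> 0}"


section \<open>Smooth functions, quotient manifolds, tangent vectors\<close>

text \<open>Meant for open \<open>U\<close> in a finite-dimensional space, where being of class \<open>C\<^sup>k\<^sup>+\<^sup>1\<close> is being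
  differentiable with all directional derivatives of class \<open>C\<^sup>k\<close>.\<close>

fun Ck_on :: "nat \<Rightarrow> 'a::euclidean_space set \<Rightarrow> ('a \<Rightarrow> 'b::real_normed_vector) \<Rightarrow> bool" where
  "Ck_on 0 U f \<longleftrightarrow> continuous_on U f"
| "Ck_on (Suc k) U f \<longleftrightarrow>
     (\<forall>x\<in>U. f differentiable (at x)) \<and> (\<forall>v. Ck_on k U (\<lambda>x. frechet_derivative f (at x) v))"

text \<open>Smoothness on an arbitrary subset, such as an embedded submanifold: locally the restriction
  of a smooth function on an open set. For open \<open>X\<close> this is \<open>C\<^sup>\<infinity>\<close> in the ordinary sense.\<close>

definition smooth_on :: "'a::euclidean_space set \<Rightarrow> ('a \<Rightarrow> 'b::real_normed_vector) \<Rightarrow> bool" where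
  "smooth_on X f \<longleftrightarrow>
     (\<forall>x\<in>X. \<exists>U g. open U \<and> x \<in> U \<and> (\<forall>k. Ck_on k U g) \<and> (\<forall>y\<in>X \<inter> U. g y = f y))"

definition quotient_topology :: "'a topology \<Rightarrow> ('a \<Rightarrow> 'b) \<Rightarrow> 'b topology" where
  "quotient_topology T \<pi> =
     topology (\<lambda>U. U \<subseteq> \<pi> ` topspace T \<and> openin T {x \<in> topspace T. \<pi> x \<in> U})"

lemma openin_quotient_topology:
  "openin (quotient_topology T \<pi>) U \<longleftrightarrow>
     U \<subseteq> \<pi> ` topspace T \<and> openin T {x \<in> topspace T. \<pi> x \<in> U}"
proof -
  have "istopology (\<lambda>U. U \<subseteq> \<pi> ` topspace T \<and> openin T {x \<in> topspace T. \<pi> x \<in> U})"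
  proof (unfold istopology_def, intro conjI allI impI)
    fix S R
    assume S: "S \<subseteq> \<pi> ` topspace T \<and> openin T {x \<in> topspace T. \<pi> x \<in> S}"
      and R: "R \<subseteq> \<pi> ` topspace T \<and> openin T {x \<in> topspace T. \<pi> x \<in> R}"
    have eq: "{x \<in> topspace T. \<pi> x \<in> S \<inter> R} =
        {x \<in> topspace T. \<pi> x \<in> S} \<inter> {x \<in> topspace T. \<pi> x \<in> R}" by auto
    show "S \<inter> R \<subseteq> \<pi> ` topspace T" using S by auto
    show "openin T {x \<in> topspace T. \<pi> x \<in> S \<inter> R}" unfolding eq using S R by blast
  next
    fix K
    assume K: "\<forall>S\<in>K. S \<subseteq> \<pi> ` topspace T \<and> openin T {x \<in> topspace T. \<pi> x \<in> S}"
    have eq: "{x \<in> topspace T. \<pi> x \<in> \<Union>K} = (\<Union>S\<in>K. {x \<in> topspace T. \<pi> x \<in> S})" by auto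
    show "\<Union>K \<subseteq> \<pi> ` topspace T" using K by auto
    show "openin T {x \<in> topspace T. \<pi> x \<in> \<Union>K}" unfolding eq using K by blast
  qed
  then show ?thesis by (simp add: quotient_topology_def)
qed

text \<open>A manifold is given by its topology (the points are the \<open>topspace\<close>) and its smooth real-valued
  functions, which determine the smooth structure. The values of such functions off the \<open>topspace\<close>
  are irrelevant.\<close>

record 'p manifold =
  mtop :: "'p topology"
  smooth_funs :: "('p \<Rightarrow> real) set"

text \<open>The manifold \<open>\<pi> ` X\<close> for a submanifold \<open>X\<close> of a Euclidean space and the quotient map \<open>\<pi>\<close> of a
  smooth free proper action: its smooth structure is the one making \<open>\<pi>\<close> a submersion, for which
  \<open>f\<close> is smooth if and only if \<open>f \<circ> \<pi>\<close> is.\<close>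

definition quotient_manifold :: "'e::euclidean_space set \<Rightarrow> ('e \<Rightarrow> 'p) \<Rightarrow> 'p manifold" where
  "quotient_manifold X \<pi> =
     \<lparr>mtop = quotient_topology (top_of_set X) \<pi>, smooth_funs = {f. smooth_on X (f \<circ> \<pi>)}\<rparr>"

definition smooth_curve :: "'p manifold \<Rightarrow> real \<Rightarrow> (real \<Rightarrow> 'p) \<Rightarrow> bool" where
  "smooth_curve M e \<gamma> \<longleftrightarrow>
     \<gamma> ` {-e<..<e} \<subseteq> topspace (mtop M) \<and> (\<forall>f\<in>smooth_funs M. smooth_on {-e<..<e} (f \<circ> \<gamma>))"

text \<open>The tangent vector of a curve \<open>\<gamma>\<close> at \<open>\<gamma> 0\<close> is the operator \<open>f \<mapsto> (f \<circ> \<gamma>)'(0)\<close> on smooth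
  functions, made total by the value 0 elsewhere.\<close>

definition velocity :: "'p manifold \<Rightarrow> (real \<Rightarrow> 'p) \<Rightarrow> ('p \<Rightarrow> real) \<Rightarrow> real" where
  "velocity M \<gamma> = (\<lambda>f. if f \<in> smooth_funs M then deriv (f \<circ> \<gamma>) 0 else 0)"

definition tangent_space :: "'p manifold \<Rightarrow> 'p \<Rightarrow> (('p \<Rightarrow> real) \<Rightarrow> real) set" where
  "tangent_space M p = {velocity M \<gamma> | \<gamma> e. e > 0 \<and> smooth_curve M e \<gamma> \<and> \<gamma> 0 = p}"

text \<open>Differential (at any point) of a smooth map from \<open>M\<close> to \<open>M'\<close> (only \<open>M'\<close> is needed).\<close>

definition differential ::
    "'q manifold \<Rightarrow> ('p \<Rightarrow> 'q) \<Rightarrow> (('p \<Rightarrow> real) \<Rightarrow> real) \<Rightarrow> ('q \<Rightarrow> real) \<Rightarrow> real" where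
  "differential M' \<phi> D = (\<lambda>f. if f \<in> smooth_funs M' then D (f \<circ> \<phi>) else 0)"


section \<open>Real vector bundles\<close>

text \<open>The data of a (topological) family of real vector spaces. Vector bundles are the locally trivial
  families, and their homomorphisms are those of families. Addition is only meaningful for
  two elements of the same fibre.\<close>

record ('b, 'e) vfamily =
  base_space :: "'b topology"
  total_space :: "'e topology"
  bproj :: "'e \<Rightarrow> 'b"
  badd :: "'e \<Rightarrow> 'e \<Rightarrow> 'e"
  bscale :: "real \<Rightarrow> 'e \<Rightarrow> 'e"

definition bundle_isomorphic :: "('b, 'e) vfamily \<Rightarrow> ('b, 'f) vfamily \<Rightarrow> bool" (infix "\<cong>\<^sub>b" 50) where
  "E \<cong>\<^sub>b F \<longleftrightarrow> base_space E = base_space F \<and>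
     (\<exists>h. homeomorphic_map (total_space E) (total_space F) h \<and>
       (\<forall>x\<in>topspace (total_space E). bproj F (h x) = bproj E x) \<and>
       (\<forall>x\<in>topspace (total_space E). \<forall>y\<in>topspace (total_space E).
          bproj E x = bproj E y \<longrightarrow> h (badd E x y) = badd F (h x) (h y)) \<and>
       (\<forall>c. \<forall>x\<in>topspace (total_space E). h (bscale E c x) = bscale F c (h x)))"

definition trivial_bundle :: "'b topology \<Rightarrow> nat \<Rightarrow> ('b, 'b \<times> (nat \<Rightarrow> real)) vfamily" where
  "trivial_bundle B k =
     \<lparr>base_space = B,
      total_space = prod_topology B (Euclidean_space k),
      bproj = fst,
      badd = (\<lambda>(b, v) (_, w). (b, \<lambda>i. v i + w i)),
      bscale = (\<lambda>c (b, v). (b, \<lambda>i. c * v i))\<rparr>"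

definition is_trivial_bundle :: "('b, 'e) vfamily \<Rightarrow> bool" where
  "is_trivial_bundle E \<longleftrightarrow> (\<exists>k. E \<cong>\<^sub>b trivial_bundle (base_space E) k)"

definition whitney_sum ::
    "('b, 'e) vfamily \<Rightarrow> ('b, 'f) vfamily \<Rightarrow> ('b, 'e \<times> 'f) vfamily" (infixr "\<oplus>\<^sub>b" 65) where
  "E \<oplus>\<^sub>b F =
     \<lparr>base_space = base_space E,
      total_space = subtopology (prod_topology (total_space E) (total_space F))
                      {(x, y). bproj E x = bproj F y},
      bproj = (\<lambda>(x, y). bproj E x),
      badd = (\<lambda>(x, y) (x', y'). (badd E x x', badd F y y')),
      bscale = (\<lambda>c (x, y). (bscale E c x, bscale F c y))\<rparr>"

definition pullback_bundle ::
    "'a topology \<Rightarrow> ('a \<Rightarrow> 'b) \<Rightarrow> ('b, 'e) vfamily \<Rightarrow> ('a, 'a \<times> 'e) vfamily" where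
  "pullback_bundle A \<phi> E =
     \<lparr>base_space = A,
      total_space = subtopology (prod_topology A (total_space E)) {(a, x). \<phi> a = bproj E x},
      bproj = fst,
      badd = (\<lambda>(a, x) (_, y). (a, badd E x y)),
      bscale = (\<lambda>c (a, x). (a, bscale E c x))\<rparr>"

text \<open>The quotient \<open>E / j F\<close> by the image of a fibrewise injective homomorphism \<open>j\<close> from \<open>F\<close> to \<open>E\<close> over
  the same base. Its elements are the cosets \<open>x + j F\<^sub>b\<close> with \<open>x \<in> E\<^sub>b\<close>. The unions over
  representatives below are unions of equal cosets.\<close>

definition bcoset :: "('b, 'e) vfamily \<Rightarrow> ('b, 'f) vfamily \<Rightarrow> ('f \<Rightarrow> 'e) \<Rightarrow> 'e \<Rightarrow> 'e set" where
  "bcoset E F j x =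
     {badd E x (j y) | y. y \<in> topspace (total_space F) \<and> bproj F y = bproj E x}"

definition quotient_bundle ::
    "('b, 'e) vfamily \<Rightarrow> ('b, 'f) vfamily \<Rightarrow> ('f \<Rightarrow> 'e) \<Rightarrow> ('b, 'e set) vfamily" where
  "quotient_bundle E F j =
     \<lparr>base_space = base_space E,
      total_space = quotient_topology (total_space E) (bcoset E F j),
      bproj = (\<lambda>A. the_elem (bproj E ` A)),
      badd = (\<lambda>A B. \<Union>x\<in>A. \<Union>y\<in>B. bcoset E F j (badd E x y)),
      bscale = (\<lambda>c A. \<Union>x\<in>A. bcoset E F j (bscale E c x))\<rparr>"

text \<open>The topology on the total space is the coarsest one for which the projection and all the
  functions \<open>df\<close>, \<open>(p, D) \<mapsto> D f\<close> with \<open>f\<close> smooth, are continuous. Since local coordinates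
  agree near any given point with globally defined smooth functions, this is the topology given by
  the charts \<open>(p, D) \<mapsto> (x\<^sub>1 p, \<dots>, x\<^sub>d p, D x\<^sub>1, \<dots>, D x\<^sub>d)\<close>.\<close>

definition tangent_bundle ::
    "'p manifold \<Rightarrow> ('p, 'p \<times> (('p \<Rightarrow> real) \<Rightarrow> real)) vfamily" where
  "tangent_bundle M =
     \<lparr>base_space = mtop M,
      total_space = subtopology (prod_topology (mtop M) (powertop_real UNIV))
                      {(p, D). p \<in> topspace (mtop M) \<and> D \<in> tangent_space M p},
      bproj = fst,
      badd = (\<lambda>(p, D) (_, D'). (p, \<lambda>f. D f + D' f)),
      bscale = (\<lambda>c (p, D). (p, \<lambda>f. c * D f))\<rparr>"

text \<open>The normal bundle \<open>\<phi>\<^sup>*TM' / TM\<close> of an embedding \<open>\<phi>\<close> of \<open>M\<close> into \<open>M'\<close>.\<close>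

definition normal_bundle ::
    "'p manifold \<Rightarrow> 'q manifold \<Rightarrow> ('p \<Rightarrow> 'q) \<Rightarrow>
      ('p, ('p \<times> 'q \<times> (('q \<Rightarrow> real) \<Rightarrow> real)) set) vfamily" where
  "normal_bundle M M' \<phi> =
     quotient_bundle (pullback_bundle (mtop M) \<phi> (tangent_bundle M')) (tangent_bundle M)
       (\<lambda>(p, D). (p, \<phi> p, differential M' \<phi> D))"


section \<open>The manifolds of a configuration\<close>

definition admissible :: "('n::finite \<Rightarrow> real^'d) \<Rightarrow> bool" where
  "admissible \<Lambda> \<longleftrightarrow>
     0 \<in> convex hull (range \<Lambda>) \<and>
     (\<forall>I. 0 \<in> convex hull (\<Lambda> ` I) \<longrightarrow> card I > CARD('d))"

definition Z_H :: "('n::finite \<Rightarrow> real^'d) \<Rightarrow> (quat^'n) set" where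
  "Z_H \<Lambda> = {q. (\<Sum>i\<in>UNIV. (norm (q$i))\<^sup>2 *\<^sub>R \<Lambda> i) = 0 \<and> (\<Sum>i\<in>UNIV. (norm (q$i))\<^sup>2) = 1}"

definition N_H :: "('n::finite \<Rightarrow> real^'d) \<Rightarrow> (quat^'n) set manifold" where
  "N_H \<Lambda> = quotient_manifold (Z_H \<Lambda>) Sp1_orbit"

definition HP :: "(quat^'n) set manifold" where
  "HP = quotient_manifold (UNIV - {0}) Hstar_orbit"

text \<open>The inclusion sends the \<open>Sp(1)\<close>-orbit of \<open>q\<close> to its \<open>\<H>\<^sup>*\<close>-orbit.\<close>

definition incl_HP :: "(quat^'n) set \<Rightarrow> (quat^'n) set" where
  "incl_HP x = (\<Union>q\<in>x. Hstar_orbit q)"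

end

theory Submission
  imports Defs
begin

text \<open>For \<open>x \<noteq> 0\<close> the matrix \<open>veronese x = (x\<^sub>i\<^sup>* x\<^sub>j / |x|\<^sup>2)\<^sub>i\<^sub>j\<close> depends only on the orbit of \<open>x\<close> and determines
  it: the normalised rows of the matrix are local sections. So both quotient manifolds are embedded
  in the same Euclidean space \<open>E\<close>, and their tangent bundles become families of subspaces of \<open>E\<close>, with
  \<open>T HP\<close> given by the images of the differentials of \<open>veronese\<close>. There \<open>T N\<close> is the kernel in
  \<open>i\<^sup>* T HP\<close> of the linear map \<open>moment : y \<mapsto> \<Sum>i. y\<^sub>i\<^sub>i \<Lambda>\<^sub>i\<close>, and the vectors \<open>u\<close> of the space of the
  configuration give normal fields \<open>y\<^sub>i\<^sub>j \<mapsto> \<langle>u, \<Lambda>\<^sub>i + \<Lambda>\<^sub>j\<rangle> y\<^sub>i\<^sub>j\<close>, on which \<open>moment\<close> is the Gram operator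
  \<open>u \<mapsto> 2 \<Sum>i. |q\<^sub>i|\<^sup>2 \<langle>u, \<Lambda>\<^sub>i\<rangle> \<Lambda>\<^sub>i\<close>. By admissibility this operator is invertible, so the normal fields
  trivialise a complement of \<open>T N\<close>.\<close>

section \<open>Functions of class \<open>C\<^sup>k\<close>\<close>

text \<open>Neither quotient comes with charts, and a tangent vector is an operator on all smooth
  functions, so neither the linear structure of a tangent space nor the topology of a tangent bundle
  is directly visible. The local sections make both accessible: through them every smooth function
  \<open>f\<close> is locally a smooth function \<open>\<phi>\<close> of the matrix, and the chain
  rule gives \<open>D f = d\<phi> (push D)\<close>, so a tangent vector is determined by its image
  in \<open>E\<close>. The normal fields are gradients in disguise: half the gradient of q |-> sum
  |q_i|^2 <u, \<Lambda>_i> is the vector with entries <u, \<Lambda>_i> q_i, and the differential of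
  \<open>veronese\<close> sends it to the field named above. That \<open>T N\<close> is the whole
  kernel of \<open>moment\<close>, and not merely contained in it, requires enough curves in
  \<open>Z_H\<close>. They are written down explicitly, their second-order corrections being found
  by inverting the Gram operator. The rest is formal: a kernel of a surjection with a continuous
  linear section gives both the quotient and the sum.\<close>

lemma Ck_on_has_derivative:
  assumes "Ck_on (Suc k) U f" "x \<in> U"
  shows "(f has_derivative frechet_derivative f (at x)) (at x)"
  using assms by (simp add: frechet_derivative_works)

lemma Ck_on_cong:
  assumes "open U" "\<And>x. x \<in> U \<Longrightarrow> f x = g x" "Ck_on k U f"
  shows "Ck_on k U g"
  using assms(2,3)
proof (induction k arbitrary: f g)
  case 0
  then show ?case by (simp cong: continuous_on_cong)
next
  case (Suc k)
  have D: "(g has_derivative frechet_derivative f (at x)) (at x)" if "x \<in> U" for x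
    using has_derivative_transform_within_open[OF Ck_on_has_derivative[OF Suc.prems(2) that]
        \<open>open U\<close> that] Suc.prems(1) by simp
  have "Ck_on k U (\<lambda>x. frechet_derivative g (at x) v)" for v
  proof (rule Suc.IH)
    show "Ck_on k U (\<lambda>x. frechet_derivative f (at x) v)" using Suc.prems(2) by simp
    show "frechet_derivative f (at x) v = frechet_derivative g (at x) v" if "x \<in> U" for x
      using frechet_derivative_at[OF D[OF that]] by simp
  qed
  then show ?case using differentiableI[OF D] by simp
qed

text \<open>Any explicit formula \<open>f'\<close> for the derivative may be supplied, so the rules
  for sums, products and compositions become inductions on \<open>k\<close> over the usual
  derivative formulas.\<close>

lemma Ck_on_SucI:
  assumes "open U" "\<And>x. x \<in> U \<Longrightarrow> (f has_derivative f' x) (at x)"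
    and "\<And>v. Ck_on k U (\<lambda>x. f' x v)"
  shows "Ck_on (Suc k) U f"
proof -
  have "Ck_on k U (\<lambda>x. frechet_derivative f (at x) v)" for v
    by (rule Ck_on_cong[OF assms(1) _ assms(3)[of v]])
      (metis assms(2) frechet_derivative_at)
  then show ?thesis using differentiableI[OF assms(2)] by simp
qed

lemma Ck_on_subset:
  assumes "Ck_on k U f" "V \<subseteq> U"
  shows "Ck_on k V f"
  using assms
proof (induction k arbitrary: f)
  case 0
  then show ?case by (auto intro: continuous_on_subset)
next
  case (Suc k)
  then show ?case by auto
qed

lemma Ck_on_Suc_imp:
  assumes "Ck_on (Suc k) U f"
  shows "Ck_on k U f"
  using assms
proof (induction k arbitrary: f)
  case 0
  then show ?case
    by (auto intro!: continuous_at_imp_continuous_on differentiable_imp_continuous_within)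
next
  case (Suc k)
  then show ?case by (metis Ck_on.simps(2))
qed

lemma Ck_on_imp_continuous_on: "Ck_on k U f \<Longrightarrow> continuous_on U f"
proof (induction k)
  case (Suc k)
  then show ?case using Ck_on_Suc_imp by blast
qed simp

lemma Ck_on_const [simp]: "Ck_on k U (\<lambda>x. c)"
  by (induction k arbitrary: c) simp_all

lemma Ck_on_bounded_linear:
  assumes "open U" "bounded_linear L" "Ck_on k U f"
  shows "Ck_on k U (\<lambda>x. L (f x))"
  using assms(3)
proof (induction k arbitrary: f)
  case 0
  then show ?case using bounded_linear.continuous_on[OF assms(2)] by simp
next
  case (Suc k)
  show ?case
  proof (rule Ck_on_SucI[OF \<open>open U\<close>])
    show "((\<lambda>x. L (f x)) has_derivative (\<lambda>v. L (frechet_derivative f (at x) v))) (at x)" if "x \<in> U" for x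
      by (rule bounded_linear.has_derivative[OF assms(2) Ck_on_has_derivative[OF Suc.prems that]])
    show "Ck_on k U (\<lambda>x. L (frechet_derivative f (at x) v))" for v
      using Suc.prems by (intro Suc.IH) simp
  qed
qed

lemma Ck_on_ident [simp]: "open U \<Longrightarrow> Ck_on k U (\<lambda>x. x)"
  by (cases k) (auto intro!: Ck_on_SucI)

lemma Ck_on_add:
  assumes "open U" "Ck_on k U f" "Ck_on k U g"
  shows "Ck_on k U (\<lambda>x. f x + g x)"
  using assms(2,3)
proof (induction k arbitrary: f g)
  case 0
  then show ?case by (simp add: continuous_on_add)
next
  case (Suc k)
  show ?case
  proof (rule Ck_on_SucI[OF \<open>open U\<close>])
    show "((\<lambda>x. f x + g x) has_derivative
        (\<lambda>v. frechet_derivative f (at x) v + frechet_derivative g (at x) v)) (at x)" if "x \<in> U" for x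
      by (rule has_derivative_add[OF Ck_on_has_derivative[OF Suc.prems(1) that]
            Ck_on_has_derivative[OF Suc.prems(2) that]])
    show "Ck_on k U (\<lambda>x. frechet_derivative f (at x) v + frechet_derivative g (at x) v)" for v
      using Suc.prems by (intro Suc.IH) simp_all
  qed
qed

lemma Ck_on_sum:
  assumes "open U" "\<And>i. i \<in> I \<Longrightarrow> Ck_on k U (f i)"
  shows "Ck_on k U (\<lambda>x. \<Sum>i\<in>I. f i x)"
  using assms(2)
proof (induction I rule: infinite_finite_induct)
  case (insert i I)
  then have "Ck_on k U (\<lambda>x. f i x + (\<Sum>i\<in>I. f i x))" by (intro Ck_on_add[OF \<open>open U\<close>]) auto
  then show ?case using insert by simp
qed simp_all

text \<open>The product rule differentiates one factor at a time, so the induction hypothesis is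
  applied to mixed pairs; the factor left alone is one degree smoother and is lowered by
  \<open>Ck_on_Suc_imp\<close>.\<close>

lemma Ck_on_bilinear:
  assumes "open U" "bounded_bilinear B" "Ck_on k U f" "Ck_on k U g"
  shows "Ck_on k U (\<lambda>x. B (f x) (g x))"
  using assms(3,4)
proof (induction k arbitrary: f g)
  case 0
  then show ?case using bounded_bilinear.continuous_on[OF assms(2)] by simp
next
  case (Suc k)
  show ?case
  proof (rule Ck_on_SucI[OF \<open>open U\<close>])
    show "((\<lambda>x. B (f x) (g x)) has_derivative
        (\<lambda>v. B (f x) (frechet_derivative g (at x) v) + B (frechet_derivative f (at x) v) (g x))) (at x)"
      if "x \<in> U" for x
      by (rule bounded_bilinear.FDERIV[OF assms(2) Ck_on_has_derivative[OF Suc.prems(1) that]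
            Ck_on_has_derivative[OF Suc.prems(2) that]])
    show "Ck_on k U (\<lambda>x. B (f x) (frechet_derivative g (at x) v) + B (frechet_derivative f (at x) v) (g x))" for v
      by (intro Ck_on_add[OF \<open>open U\<close>] Suc.IH Ck_on_Suc_imp[OF Suc.prems(1)]
          Ck_on_Suc_imp[OF Suc.prems(2)]) (use Suc.prems in simp_all)
  qed
qed

lemmas Ck_on_mult = Ck_on_bilinear[OF _ bounded_bilinear_mult]
lemmas Ck_on_scaleR = Ck_on_bilinear[OF _ bounded_bilinear_scaleR]
lemmas Ck_on_inner = Ck_on_bilinear[OF _ bounded_bilinear_inner]

lemma linear_Basis_expansion:
  fixes v :: "'a::euclidean_space"
  assumes "linear L"
  shows "L v = (\<Sum>b\<in>Basis. (v \<bullet> b) *\<^sub>R L b)"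
proof -
  have "L v = L (\<Sum>b\<in>Basis. (v \<bullet> b) *\<^sub>R b)" by (simp add: euclidean_representation)
  then show ?thesis by (simp add: linear_sum[OF assms] linear_cmul[OF assms])
qed

text \<open>In the chain rule the direction fed to the derivative of \<open>g\<close> varies with
  \<open>x\<close>, whereas \<open>Ck_on\<close> controls derivatives in fixed directions only.
  Expanding that direction in the basis leaves a finite sum of products of functions already under
  control.\<close>

lemma Ck_on_compose:
  fixes f :: "'a::euclidean_space \<Rightarrow> 'b::euclidean_space"
  assumes "open U" "open V" "f ` U \<subseteq> V" "Ck_on k V g" "Ck_on k U f"
  shows "Ck_on k U (\<lambda>x. g (f x))"
  using assms(4,5)
proof (induction k arbitrary: g)
  case 0
  then show ?case using assms(3) continuous_on_compose2 by auto
next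
  case (Suc k)
  have fV: "f x \<in> V" if "x \<in> U" for x using that assms(3) by auto
  show ?case
  proof (rule Ck_on_SucI[OF \<open>open U\<close>])
    fix x assume x: "x \<in> U"
    have g: "(g has_derivative frechet_derivative g (at (f x))) (at (f x))"
      by (rule Ck_on_has_derivative[OF Suc.prems(1) fV[OF x]])
    have "((\<lambda>x. g (f x)) has_derivative
        (\<lambda>v. frechet_derivative g (at (f x)) (frechet_derivative f (at x) v))) (at x)"
      by (rule has_derivative_compose[OF Ck_on_has_derivative[OF Suc.prems(2) x] g])
    moreover have "(\<lambda>v. frechet_derivative g (at (f x)) (frechet_derivative f (at x) v)) =
        (\<lambda>v. \<Sum>b\<in>Basis. (frechet_derivative f (at x) v \<bullet> b) *\<^sub>R frechet_derivative g (at (f x)) b)"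
      by (intro ext linear_Basis_expansion has_derivative_linear[OF g])
    ultimately show "((\<lambda>x. g (f x)) has_derivative
        (\<lambda>v. \<Sum>b\<in>Basis. (frechet_derivative f (at x) v \<bullet> b) *\<^sub>R frechet_derivative g (at (f x)) b)) (at x)"
      by (rule has_derivative_eq_rhs)
  next
    fix v
    show "Ck_on k U (\<lambda>x. \<Sum>b\<in>Basis. (frechet_derivative f (at x) v \<bullet> b) *\<^sub>R frechet_derivative g (at (f x)) b)"
    proof (intro Ck_on_sum Ck_on_scaleR Ck_on_inner Ck_on_const \<open>open U\<close>)
      show "Ck_on k U (\<lambda>x. frechet_derivative f (at x) v)" using Suc.prems(2) by simp
      show "Ck_on k U (\<lambda>x. frechet_derivative g (at (f x)) b)" for b
        by (rule Suc.IH[OF _ Ck_on_Suc_imp[OF Suc.prems(2)]]) (use Suc.prems(1) in simp)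
    qed
  qed
qed

text \<open>The exponent is general because differentiation lowers it by 1; one induction then
  serves both square roots and inverses.\<close>

lemma Ck_on_powr: "Ck_on k {0<..} (\<lambda>x::real. x powr a)"
proof (induction k arbitrary: a)
  case 0
  then show ?case by (auto intro!: continuous_intros)
next
  case (Suc k)
  show ?case
  proof (rule Ck_on_SucI)
    show "((\<lambda>x. x powr a) has_derivative (\<lambda>v. v * (a * x powr (a - 1)))) (at x)" if "x \<in> {0<..}" for x
      using that has_real_derivative_powr[of x a]
      by (simp add: has_field_derivative_def mult_commute_abs)
    show "Ck_on k {0<..} (\<lambda>x. v * (a * x powr (a - 1)))" for v
      by (intro Ck_on_mult Ck_on_const Suc.IH) simp_all
  qed simp
qed

lemma Ck_on_powr_compose:
  fixes f :: "'a::euclidean_space \<Rightarrow> real"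
  assumes "open U" "\<And>x. x \<in> U \<Longrightarrow> f x > 0" "Ck_on k U f"
  shows "Ck_on k U (\<lambda>x. f x powr a)"
  by (rule Ck_on_compose[OF assms(1) _ _ Ck_on_powr assms(3)]) (use assms(2) in auto)

lemma Ck_on_sqrt:
  fixes f :: "'a::euclidean_space \<Rightarrow> real"
  assumes "open U" "\<And>x. x \<in> U \<Longrightarrow> f x > 0" "Ck_on k U f"
  shows "Ck_on k U (\<lambda>x. sqrt (f x))"
  by (rule Ck_on_cong[OF assms(1) _ Ck_on_powr_compose[OF assms, of "1/2"]])
    (simp add: powr_half_sqrt assms(2) less_imp_le)

lemma Ck_on_inverse:
  fixes f :: "'a::euclidean_space \<Rightarrow> real"
  assumes "open U" "\<And>x. x \<in> U \<Longrightarrow> f x > 0" "Ck_on k U f"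
  shows "Ck_on k U (\<lambda>x. inverse (f x))"
  by (rule Ck_on_cong[OF assms(1) _ Ck_on_powr_compose[OF assms, of "-1"]])
    (simp add: powr_minus assms(2) less_imp_le)

lemma bounded_linear_axis: "bounded_linear (\<lambda>v::'b::euclidean_space. axis i v :: 'b^'i::finite)"
proof -
  have "linear (\<lambda>v::'b. axis i v :: 'b^'i)"
    by (rule linearI) (simp_all add: axis_def vec_eq_iff)
  then show ?thesis by (rule linear_conv_bounded_linear[THEN iffD1])
qed

text \<open>Presents a vector as a finite sum of linear images of its components, so that smoothness
  and derivatives pass from components to vectors.\<close>

lemma vec_eq_sum_axis: "(\<chi> i. f i) = (\<Sum>i\<in>UNIV. axis i (f i))"
  by (simp add: vec_eq_iff axis_def if_distrib sum.delta cong: if_cong)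

lemma Ck_on_vec_lambda:
  fixes f :: "'a::euclidean_space \<Rightarrow> 'i::finite \<Rightarrow> 'b::euclidean_space"
  assumes "open U" "\<And>i. Ck_on k U (\<lambda>x. f x i)"
  shows "Ck_on k U (\<lambda>x. \<chi> i. f x i)"
  unfolding vec_eq_sum_axis
  by (rule Ck_on_sum[OF assms(1) Ck_on_bounded_linear[OF assms(1) bounded_linear_axis assms(2)]])

lemma Ck_on_vec_nth:
  assumes "open U" "Ck_on k U f"
  shows "Ck_on k U (\<lambda>x. f x $ i)"
  by (rule Ck_on_bounded_linear[OF assms(1) bounded_linear_vec_nth assms(2)])

text \<open>\<open>Ck_on\<close> gives continuity for each fixed direction; joint continuity in
  point and direction follows from linearity and a finite basis. The topology of the tangent bundle
  needs the joint form.\<close>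

lemma continuous_on_frechet_derivative:
  assumes "Ck_on (Suc 0) U g"
  shows "continuous_on (U \<times> UNIV) (\<lambda>(x, v). frechet_derivative g (at x) v)"
proof -
  have cont: "continuous_on (U \<times> UNIV)
      (\<lambda>z. \<Sum>b\<in>Basis. (snd z \<bullet> b) *\<^sub>R frechet_derivative g (at (fst z)) b)"
  proof (intro continuous_intros)
    fix b :: 'a
    have "continuous_on U (\<lambda>x. frechet_derivative g (at x) b)" using assms by simp
    then show "continuous_on (U \<times> UNIV) (\<lambda>z. frechet_derivative g (at (fst z)) b)"
      by (rule continuous_on_compose2) (auto intro!: continuous_intros)
  qed
  have "(\<Sum>b\<in>Basis. (snd z \<bullet> b) *\<^sub>R frechet_derivative g (at (fst z)) b) =
      (\<lambda>(x, v). frechet_derivative g (at x) v) z" if "z \<in> U \<times> UNIV" for z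
  proof -
    have "fst z \<in> U" using that by auto
    then have "linear (frechet_derivative g (at (fst z)))"
      by (rule has_derivative_linear[OF Ck_on_has_derivative[OF assms]])
    from linear_Basis_expansion[OF this, of "snd z"] show ?thesis by (simp add: case_prod_beta)
  qed
  with cont show ?thesis
    by (rule continuous_on_eq)
qed

section \<open>Smoothness on arbitrary subsets\<close>

lemma smooth_onI:
  assumes "\<And>x. x \<in> X \<Longrightarrow> open (U x)" "\<And>x. x \<in> X \<Longrightarrow> x \<in> U x"
    and "\<And>x k. x \<in> X \<Longrightarrow> Ck_on k (U x) (g x)"
    and "\<And>x y. x \<in> X \<Longrightarrow> y \<in> X \<Longrightarrow> y \<in> U x \<Longrightarrow> g x y = f y"
  shows "smooth_on X f"
  unfolding smooth_on_def
proof
  fix x assume "x \<in> X"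
  then show "\<exists>U g. open U \<and> x \<in> U \<and> (\<forall>k. Ck_on k U g) \<and> (\<forall>y\<in>X \<inter> U. g y = f y)"
    using assms by (intro exI[of _ "U x"] exI[of _ "g x"]) simp
qed

lemma smooth_onE:
  assumes "smooth_on X f" "x \<in> X"
  obtains U g where "open U" "x \<in> U" "\<And>k. Ck_on k U g" "\<And>y. y \<in> X \<Longrightarrow> y \<in> U \<Longrightarrow> g y = f y"
proof -
  obtain U g where "open U" "x \<in> U" "\<forall>k. Ck_on k U g" "\<forall>y\<in>X \<inter> U. g y = f y"
    using bspec[OF assms(1)[unfolded smooth_on_def] assms(2)] by (elim exE conjE)
  then show ?thesis by (intro that[of U g]) simp_all
qed

lemma smooth_on_imp_continuous_on:
  assumes "smooth_on X f"
  shows "continuous_on X f"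
  unfolding continuous_on_eq_continuous_within
proof
  fix x assume x: "x \<in> X"
  obtain U g where U: "open U" "x \<in> U" "\<And>k. Ck_on k U g" "\<And>y. y \<in> X \<Longrightarrow> y \<in> U \<Longrightarrow> g y = f y"
    by (rule smooth_onE[OF assms x]) (rule that)
  have "continuous_on (X \<inter> U) g"
    by (rule continuous_on_subset[OF Ck_on_imp_continuous_on[OF U(3)[of 0]]]) simp
  then have "continuous_on (X \<inter> U) f"
    by (rule continuous_on_eq) (use U(4) in auto)
  then have "continuous (at x within X \<inter> U) f"
    using U(2) x by (simp add: continuous_on_eq_continuous_within)
  moreover have "at x within X \<inter> U = at x within X"
    by (rule at_within_nhd[OF U(2,1)]) blast
  ultimately show "continuous (at x within X) f" by simp
qed

lemma smooth_on_open_differentiable: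
  assumes "smooth_on U f" "open U" "x \<in> U"
  shows "f differentiable (at x)"
proof -
  obtain V g where V: "open V" "x \<in> V" "\<And>k. Ck_on k V g" "\<And>y. y \<in> U \<Longrightarrow> y \<in> V \<Longrightarrow> g y = f y"
    by (rule smooth_onE[OF assms(1,3)]) (rule that)
  have "(f has_derivative frechet_derivative g (at x)) (at x)"
    by (rule has_derivative_transform_within_open[OF Ck_on_has_derivative[OF V(3,2)], of "U \<inter> V"])
      (use V assms in auto)
  then show ?thesis by (rule differentiableI)
qed

lemma smooth_on_openI: "open U \<Longrightarrow> (\<And>k. Ck_on k U f) \<Longrightarrow> X \<subseteq> U \<Longrightarrow> smooth_on X f"
  by (rule smooth_onI[where U = "\<lambda>_. U" and g = "\<lambda>_. f"]) blast+

lemma smooth_on_subset: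
  assumes "smooth_on X f" "Y \<subseteq> X"
  shows "smooth_on Y f"
  unfolding smooth_on_def
proof
  fix x assume "x \<in> Y"
  then have "x \<in> X" using assms(2) by blast
  then obtain U g where "open U" "x \<in> U" "\<And>k. Ck_on k U g" "\<And>y. y \<in> X \<Longrightarrow> y \<in> U \<Longrightarrow> g y = f y"
    by (rule smooth_onE[OF assms(1)]) (rule that)
  then show "\<exists>U g. open U \<and> x \<in> U \<and> (\<forall>k. Ck_on k U g) \<and> (\<forall>y\<in>Y \<inter> U. g y = f y)"
    using assms(2) by (intro exI[of _ U] exI[of _ g]) auto
qed

lemma smooth_on_cong:
  assumes "\<And>x. x \<in> X \<Longrightarrow> f x = g x"
  shows "smooth_on X f \<longleftrightarrow> smooth_on X g"
  unfolding smooth_on_def by (simp add: assms)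

lemma smooth_on_bounded_linear:
  assumes "bounded_linear L" "smooth_on X f"
  shows "smooth_on X (\<lambda>x. L (f x))"
  unfolding smooth_on_def
proof
  fix x assume "x \<in> X"
  then obtain U g where U: "open U" "x \<in> U" "\<And>k. Ck_on k U g" "\<And>y. y \<in> X \<Longrightarrow> y \<in> U \<Longrightarrow> g y = f y"
    by (rule smooth_onE[OF assms(2)]) (rule that)
  have "\<forall>k. Ck_on k U (\<lambda>x. L (g x))"
    using Ck_on_bounded_linear[OF U(1) assms(1)] U(3) by blast
  with U show "\<exists>U h. open U \<and> x \<in> U \<and> (\<forall>k. Ck_on k U h) \<and> (\<forall>y\<in>X \<inter> U. h y = L (f y))"
    by (intro exI[of _ U] exI[of _ "\<lambda>x. L (g x)"]) simp
qed

lemma smooth_on_compose: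
  fixes f :: "'a::euclidean_space \<Rightarrow> 'b::euclidean_space"
  assumes "open U" "\<And>k. Ck_on k U f" "f ` U \<subseteq> X" "smooth_on X g"
  shows "smooth_on U (\<lambda>x. g (f x))"
  unfolding smooth_on_def
proof
  fix x assume x: "x \<in> U"
  then have "f x \<in> X" using assms(3) by blast
  then obtain V h where V: "open V" "f x \<in> V" "\<And>k. Ck_on k V h" "\<And>y. y \<in> X \<Longrightarrow> y \<in> V \<Longrightarrow> h y = g y"
    by (rule smooth_onE[OF assms(4)]) (rule that)
  have cont: "continuous_on U f" by (rule Ck_on_imp_continuous_on[OF assms(2)[of 0]])
  have op: "open (U \<inter> f -` V)" by (rule continuous_open_preimage[OF cont assms(1) V(1)])
  show "\<exists>V h. open V \<and> x \<in> V \<and> (\<forall>k. Ck_on k V h) \<and> (\<forall>y\<in>U \<inter> V. h y = g (f y))"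
  proof (intro exI conjI allI)
    show "Ck_on k (U \<inter> f -` V) (\<lambda>x. h (f x))" for k
      by (rule Ck_on_compose[OF op V(1) _ V(3) Ck_on_subset[OF assms(2)]]) auto
    show "\<forall>y\<in>U \<inter> (U \<inter> f -` V). h (f y) = g (f y)" using V(4) assms(3) by blast
  qed (use op x V in auto)
qed

section \<open>Quotient topologies and families of vector spaces\<close>

lemma topspace_quotient_topology [simp]: "topspace (quotient_topology T \<pi>) = \<pi> ` topspace T"
proof
  show "topspace (quotient_topology T \<pi>) \<subseteq> \<pi> ` topspace T"
    using openin_topspace[of "quotient_topology T \<pi>"] unfolding openin_quotient_topology by blast
  have "{x \<in> topspace T. \<pi> x \<in> \<pi> ` topspace T} = topspace T" by blast
  then have "openin (quotient_topology T \<pi>) (\<pi> ` topspace T)"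
    unfolding openin_quotient_topology by simp
  then show "\<pi> ` topspace T \<subseteq> topspace (quotient_topology T \<pi>)"
    by (rule openin_subset)
qed

lemma continuous_map_to_quotient_topology: "continuous_map T (quotient_topology T \<pi>) \<pi>"
  unfolding continuous_map_def by (auto simp: openin_quotient_topology)

lemma continuous_map_from_quotient_topology:
  assumes "continuous_map T Y (f \<circ> \<pi>)"
  shows "continuous_map (quotient_topology T \<pi>) Y f"
  unfolding continuous_map_def
proof (intro conjI allI impI)
  show "f \<in> topspace (quotient_topology T \<pi>) \<rightarrow> topspace Y"
    using continuous_map_funspace[OF assms] by auto
  fix U assume "openin Y U"
  then have "openin T {x \<in> topspace T. (f \<circ> \<pi>) x \<in> U}"
    using assms openin_continuous_map_preimage by blast
  moreover have "{x \<in> topspace T. \<pi> x \<in> {y \<in> topspace (quotient_topology T \<pi>). f y \<in> U}} =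
      {x \<in> topspace T. (f \<circ> \<pi>) x \<in> U}" by auto
  ultimately show "openin (quotient_topology T \<pi>) {y \<in> topspace (quotient_topology T \<pi>). f y \<in> U}"
    by (auto simp: openin_quotient_topology)
qed

section \<open>Isomorphisms of families of vector spaces\<close>

lemma bundle_isomorphicI:
  assumes "base_space E = base_space F"
    and "homeomorphic_maps (total_space E) (total_space F) h g"
    and "\<And>x. x \<in> topspace (total_space E) \<Longrightarrow> bproj F (h x) = bproj E x"
    and "\<And>x y. x \<in> topspace (total_space E) \<Longrightarrow> y \<in> topspace (total_space E) \<Longrightarrow>
           bproj E x = bproj E y \<Longrightarrow> h (badd E x y) = badd F (h x) (h y)"
    and "\<And>c x. x \<in> topspace (total_space E) \<Longrightarrow> h (bscale E c x) = bscale F c (h x)"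
  shows "E \<cong>\<^sub>b F"
  unfolding bundle_isomorphic_def using assms homeomorphic_map_maps by blast

lemma bundle_isomorphicE:
  assumes "E \<cong>\<^sub>b F"
  obtains h g where "base_space E = base_space F"
    and "homeomorphic_maps (total_space E) (total_space F) h g"
    and "\<And>x. x \<in> topspace (total_space E) \<Longrightarrow> bproj F (h x) = bproj E x"
    and "\<And>x y. x \<in> topspace (total_space E) \<Longrightarrow> y \<in> topspace (total_space E) \<Longrightarrow>
           bproj E x = bproj E y \<Longrightarrow> h (badd E x y) = badd F (h x) (h y)"
    and "\<And>c x. x \<in> topspace (total_space E) \<Longrightarrow> h (bscale E c x) = bscale F c (h x)"
proof -
  obtain h where h: "base_space E = base_space F"
    "homeomorphic_map (total_space E) (total_space F) h"
    "\<forall>x\<in>topspace (total_space E). bproj F (h x) = bproj E x"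
    "\<forall>x\<in>topspace (total_space E). \<forall>y\<in>topspace (total_space E).
       bproj E x = bproj E y \<longrightarrow> h (badd E x y) = badd F (h x) (h y)"
    "\<forall>c. \<forall>x\<in>topspace (total_space E). h (bscale E c x) = bscale F c (h x)"
    using assms unfolding bundle_isomorphic_def by (elim conjE exE)
  obtain g where "homeomorphic_maps (total_space E) (total_space F) h g"
    using h(2) unfolding homeomorphic_map_maps ..
  then show thesis using h by (intro that[of h g]) simp_all
qed

lemma homeomorphic_maps_inverse:
  assumes "homeomorphic_maps X Y f g"
  shows "x \<in> topspace X \<Longrightarrow> f x \<in> topspace Y" "y \<in> topspace Y \<Longrightarrow> g y \<in> topspace X"
    "x \<in> topspace X \<Longrightarrow> g (f x) = x" "y \<in> topspace Y \<Longrightarrow> f (g y) = y"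
  using assms continuous_map_image_subset_topspace
  unfolding homeomorphic_maps_def by blast+

lemma bundle_isomorphic_trans:
  assumes "E \<cong>\<^sub>b F" "F \<cong>\<^sub>b G"
  shows "E \<cong>\<^sub>b G"
proof -
  obtain h g where h: "base_space E = base_space F"
    "homeomorphic_maps (total_space E) (total_space F) h g"
    "\<And>x. x \<in> topspace (total_space E) \<Longrightarrow> bproj F (h x) = bproj E x"
    "\<And>x y. x \<in> topspace (total_space E) \<Longrightarrow> y \<in> topspace (total_space E) \<Longrightarrow>
       bproj E x = bproj E y \<Longrightarrow> h (badd E x y) = badd F (h x) (h y)"
    "\<And>c x. x \<in> topspace (total_space E) \<Longrightarrow> h (bscale E c x) = bscale F c (h x)"
    by (rule bundle_isomorphicE[OF assms(1)]) (rule that)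
  obtain k l where k: "base_space F = base_space G"
    "homeomorphic_maps (total_space F) (total_space G) k l"
    "\<And>x. x \<in> topspace (total_space F) \<Longrightarrow> bproj G (k x) = bproj F x"
    "\<And>x y. x \<in> topspace (total_space F) \<Longrightarrow> y \<in> topspace (total_space F) \<Longrightarrow>
       bproj F x = bproj F y \<Longrightarrow> k (badd F x y) = badd G (k x) (k y)"
    "\<And>c x. x \<in> topspace (total_space F) \<Longrightarrow> k (bscale F c x) = bscale G c (k x)"
    by (rule bundle_isomorphicE[OF assms(2)]) (rule that)
  note hF = homeomorphic_maps_inverse(1)[OF h(2)]
  show ?thesis
    by (rule bundle_isomorphicI[OF _ homeomorphic_maps_compose[OF conjI[OF h(2) k(2)]]])
      (simp_all add: h k hF)
qed

text \<open>Nothing in the record forces the operations to stay in the total space. Reversing an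
  isomorphism needs it: the inverse undoes \<open>h\<close> only on the total space, and it has to
  be applied to the image of a sum formed in \<open>E\<close>.\<close>

definition fibrewise_closed :: "('b, 'e) vfamily \<Rightarrow> bool" where
  "fibrewise_closed E \<longleftrightarrow>
     (\<forall>x\<in>topspace (total_space E). \<forall>y\<in>topspace (total_space E).
        bproj E x = bproj E y \<longrightarrow> badd E x y \<in> topspace (total_space E)) \<and>
     (\<forall>c. \<forall>x\<in>topspace (total_space E). bscale E c x \<in> topspace (total_space E))"

lemma bundle_isomorphic_sym:
  assumes "E \<cong>\<^sub>b F" "fibrewise_closed E"
  shows "F \<cong>\<^sub>b E"
proof -
  obtain h g where h: "base_space E = base_space F"
    "homeomorphic_maps (total_space E) (total_space F) h g"
    "\<And>x. x \<in> topspace (total_space E) \<Longrightarrow> bproj F (h x) = bproj E x"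
    "\<And>x y. x \<in> topspace (total_space E) \<Longrightarrow> y \<in> topspace (total_space E) \<Longrightarrow>
       bproj E x = bproj E y \<Longrightarrow> h (badd E x y) = badd F (h x) (h y)"
    "\<And>c x. x \<in> topspace (total_space E) \<Longrightarrow> h (bscale E c x) = bscale F c (h x)"
    by (rule bundle_isomorphicE[OF assms(1)]) (rule that)
  note hg = homeomorphic_maps_inverse[OF h(2)]
  have proj: "bproj E (g x) = bproj F x" if "x \<in> topspace (total_space F)" for x
    using h(3)[of "g x"] hg that by simp
  show ?thesis
  proof (rule bundle_isomorphicI)
    show "homeomorphic_maps (total_space F) (total_space E) g h"
      using h(2) homeomorphic_maps_sym by blast
    fix x y assume xy: "x \<in> topspace (total_space F)" "y \<in> topspace (total_space F)" "bproj F x = bproj F y"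
    then have "badd E (g x) (g y) \<in> topspace (total_space E)"
      using assms(2) hg(2) proj unfolding fibrewise_closed_def by simp
    moreover have "h (badd E (g x) (g y)) = badd F x y"
      using h(4)[of "g x" "g y"] xy hg proj by simp
    ultimately show "g (badd F x y) = badd E (g x) (g y)" using hg(3) by metis
  next
    fix c x assume x: "x \<in> topspace (total_space F)"
    then have "bscale E c (g x) \<in> topspace (total_space E)"
      using assms(2) hg(2) unfolding fibrewise_closed_def by simp
    moreover have "h (bscale E c (g x)) = bscale F c x"
      using h(5)[of "g x" c] x hg by simp
    ultimately show "g (bscale F c x) = bscale E c (g x)" using hg(3) by metis
  qed (simp_all add: h proj)
qed

lemma continuous_map_subtopology_prod:
  assumes "continuous_map X X' f" "continuous_map Y Y' g"
    and "\<And>x y. x \<in> topspace X \<Longrightarrow> y \<in> topspace Y \<Longrightarrow> (x, y) \<in> S \<Longrightarrow> (f x, g y) \<in> S'"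
  shows "continuous_map (subtopology (prod_topology X Y) S) (subtopology (prod_topology X' Y') S')
           (\<lambda>(x, y). (f x, g y))"
proof -
  have "continuous_map (prod_topology X Y) (prod_topology X' Y') (\<lambda>(x, y). (f x, g y))"
    using assms(1,2) by (simp add: continuous_map_prod_top)
  then show ?thesis
    using assms(3) by (intro continuous_map_into_subtopology continuous_map_from_subtopology) auto
qed

lemma whitney_sum_cong:
  assumes "E \<cong>\<^sub>b E'" "F \<cong>\<^sub>b F'"
  shows "E \<oplus>\<^sub>b F \<cong>\<^sub>b E' \<oplus>\<^sub>b F'"
proof -
  obtain h g where h: "base_space E = base_space E'"
    "homeomorphic_maps (total_space E) (total_space E') h g"
    "\<And>x. x \<in> topspace (total_space E) \<Longrightarrow> bproj E' (h x) = bproj E x"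
    "\<And>x y. x \<in> topspace (total_space E) \<Longrightarrow> y \<in> topspace (total_space E) \<Longrightarrow>
       bproj E x = bproj E y \<Longrightarrow> h (badd E x y) = badd E' (h x) (h y)"
    "\<And>c x. x \<in> topspace (total_space E) \<Longrightarrow> h (bscale E c x) = bscale E' c (h x)"
    by (rule bundle_isomorphicE[OF assms(1)]) (rule that)
  obtain k l where k: "base_space F = base_space F'"
    "homeomorphic_maps (total_space F) (total_space F') k l"
    "\<And>x. x \<in> topspace (total_space F) \<Longrightarrow> bproj F' (k x) = bproj F x"
    "\<And>x y. x \<in> topspace (total_space F) \<Longrightarrow> y \<in> topspace (total_space F) \<Longrightarrow>
       bproj F x = bproj F y \<Longrightarrow> k (badd F x y) = badd F' (k x) (k y)"
    "\<And>c x. x \<in> topspace (total_space F) \<Longrightarrow> k (bscale F c x) = bscale F' c (k x)"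
    by (rule bundle_isomorphicE[OF assms(2)]) (rule that)
  note hg = homeomorphic_maps_inverse[OF h(2)]
  note kl = homeomorphic_maps_inverse[OF k(2)]
  have hproj: "bproj E (g x) = bproj E' x" if "x \<in> topspace (total_space E')" for x
    using h(3)[of "g x"] hg that by simp
  have kproj: "bproj F (l x) = bproj F' x" if "x \<in> topspace (total_space F')" for x
    using k(3)[of "l x"] kl that by simp
  have "homeomorphic_maps (total_space (E \<oplus>\<^sub>b F)) (total_space (E' \<oplus>\<^sub>b F'))
      (\<lambda>(x, y). (h x, k y)) (\<lambda>(x, y). (g x, l y))"
    unfolding homeomorphic_maps_def
  proof (intro conjI)
    show "continuous_map (total_space (E \<oplus>\<^sub>b F)) (total_space (E' \<oplus>\<^sub>b F')) (\<lambda>(x, y). (h x, k y))"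
      unfolding whitney_sum_def using h(2,3) k(2,3)
      by (auto simp: homeomorphic_maps_def intro!: continuous_map_subtopology_prod)
    show "continuous_map (total_space (E' \<oplus>\<^sub>b F')) (total_space (E \<oplus>\<^sub>b F)) (\<lambda>(x, y). (g x, l y))"
      unfolding whitney_sum_def using h(2) k(2) hproj kproj
      by (auto simp: homeomorphic_maps_def intro!: continuous_map_subtopology_prod)
  qed (auto simp: whitney_sum_def hg kl)
  then show ?thesis
    by (rule bundle_isomorphicI[rotated]) (auto simp: whitney_sum_def h k)
qed

section \<open>Families of subsets of a fixed vector space, and their splittings\<close>

definition subbundle ::
    "'b topology \<Rightarrow> ('b \<Rightarrow> 'v::real_normed_vector set) \<Rightarrow> ('b, 'b \<times> 'v) vfamily" where
  "subbundle B K =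
     \<lparr>base_space = B,
      total_space = subtopology (prod_topology B euclidean) {(b, v). v \<in> K b},
      bproj = fst,
      badd = (\<lambda>(b, v) (_, w). (b, v + w)),
      bscale = (\<lambda>c (b, v). (b, c *\<^sub>R v))\<rparr>"

lemma subbundle_simps [simp]:
  "base_space (subbundle B K) = B" "bproj (subbundle B K) = fst"
  "topspace (total_space (subbundle B K)) = {(b, v). b \<in> topspace B \<and> v \<in> K b}"
  "badd (subbundle B K) (b, v) (b', w) = (b, v + w)"
  "bscale (subbundle B K) c (b, v) = (b, c *\<^sub>R v)"
  by (auto simp: subbundle_def)

lemma continuous_map_into_subbundle:
  assumes "continuous_map X B f" "continuous_map X euclidean g"
    and "\<And>x. x \<in> topspace X \<Longrightarrow> g x \<in> K (f x)"
  shows "continuous_map X (total_space (subbundle B K)) (\<lambda>x. (f x, g x))"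
  unfolding subbundle_def using assms
  by (auto intro!: continuous_map_into_subtopology continuous_map_pairedI)

lemma continuous_map_subbundle_fst: "continuous_map (total_space (subbundle B K)) B fst"
  and continuous_map_subbundle_snd: "continuous_map (total_space (subbundle B K)) euclidean snd"
  by (auto simp: subbundle_def
      intro: continuous_map_from_subtopology continuous_map_fst continuous_map_snd)

text \<open>A split short exact sequence varying continuously over \<open>B\<close>:
  \<open>Y p\<close> maps \<open>K' p\<close> onto the fixed space with kernel \<open>K p\<close>,
  and \<open>X p\<close> is a linear section of it. Both halves of the theorem are read off from
  this one datum.\<close>

locale subbundle_splitting =
  fixes B :: "'b topology" and K K' :: "'b \<Rightarrow> 'v::real_normed_vector set"
    and X :: "'b \<Rightarrow> 'w::real_normed_vector \<Rightarrow> 'v" and Y :: "'b \<Rightarrow> 'v \<Rightarrow> 'w"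
  assumes X: "continuous_map (prod_topology B euclidean) euclidean (\<lambda>(p, u). X p u)"
    and Y: "continuous_map (prod_topology B euclidean) euclidean (\<lambda>(p, v). Y p v)"
    and linear_X: "linear (X p)" and linear_Y: "linear (Y p)"
    and subspace: "p \<in> topspace B \<Longrightarrow> subspace (K' p)"
    and X_in: "p \<in> topspace B \<Longrightarrow> X p u \<in> K' p"
    and YX: "p \<in> topspace B \<Longrightarrow> Y p (X p u) = u"
    and K_eq: "p \<in> topspace B \<Longrightarrow> K p = {v \<in> K' p. Y p v = 0}"
begin

text \<open>The map is addition, (v, u) |-> v + X u. Its inverse is v |-> (v - X (Y v), Y v), where
  v - X (Y v) is the projection of \<open>K'\<close> onto \<open>K\<close> along the image of
  \<open>X\<close>.\<close>

lemma whitney_sum_isomorphic: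
  "subbundle B K \<oplus>\<^sub>b subbundle B (\<lambda>_. UNIV :: 'w set) \<cong>\<^sub>b subbundle B K'"
proof (rule bundle_isomorphicI)
  have Kd: "v - X p (Y p v) \<in> K p" if "p \<in> topspace B" "v \<in> K' p" for p v
    using that by (simp add: K_eq linear_diff[OF linear_Y] YX subspace_diff subspace X_in)
  let ?W = "subbundle B K \<oplus>\<^sub>b subbundle B (\<lambda>_. UNIV) :: ('b, ('b \<times> 'v) \<times> ('b \<times> 'w)) vfamily"
  let ?h = "\<lambda>z :: ('b \<times> 'v) \<times> ('b \<times> 'w). (fst (fst z), snd (fst z) + X (fst (fst z)) (snd (snd z)))"
  let ?g = "\<lambda>z. ((fst z, snd z - X (fst z) (Y (fst z) (snd z))), (fst z, Y (fst z) (snd z)))"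
  have top: "topspace (total_space ?W) = {((p, v), (p', u)). p = p' \<and> p \<in> topspace B \<and> v \<in> K p}"
    by (auto simp: whitney_sum_def)
  have c1: "continuous_map (total_space ?W) (total_space (subbundle B K)) fst"
    and c2: "continuous_map (total_space ?W) (total_space (subbundle B (\<lambda>_. UNIV::'w set))) snd"
    by (auto simp: whitney_sum_def intro: continuous_map_from_subtopology continuous_map_fst continuous_map_snd)
  have c11: "continuous_map (total_space ?W) B (\<lambda>z. fst (fst z))"
    using continuous_map_compose[OF c1 continuous_map_subbundle_fst] by (simp add: o_def)
  have c12: "continuous_map (total_space ?W) euclidean (\<lambda>z. snd (fst z))"
    using continuous_map_compose[OF c1 continuous_map_subbundle_snd] by (simp add: o_def)
  have c22: "continuous_map (total_space ?W) euclidean (\<lambda>z. snd (snd z))"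
    using continuous_map_compose[OF c2 continuous_map_subbundle_snd] by (simp add: o_def)
  have cX: "continuous_map (total_space ?W) euclidean (\<lambda>z. X (fst (fst z)) (snd (snd z)))"
    using continuous_map_compose[OF continuous_map_pairedI[OF c11 c22] X] by (simp add: o_def case_prod_unfold)
  have h: "continuous_map (total_space ?W) (total_space (subbundle B K')) ?h"
    by (rule continuous_map_into_subbundle[OF c11 continuous_map_add[OF c12 cX]])
      (auto simp: top K_eq intro!: subspace_add subspace X_in)
  have d1: "continuous_map (total_space (subbundle B K')) B fst"
    and d2: "continuous_map (total_space (subbundle B K')) euclidean snd"
    by (rule continuous_map_subbundle_fst continuous_map_subbundle_snd)+
  have dY: "continuous_map (total_space (subbundle B K')) euclidean (\<lambda>z. Y (fst z) (snd z))"
    using continuous_map_compose[OF continuous_map_pairedI[OF d1 d2] Y] by (simp add: o_def case_prod_unfold)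
  have dX: "continuous_map (total_space (subbundle B K')) euclidean (\<lambda>z. X (fst z) (Y (fst z) (snd z)))"
    using continuous_map_compose[OF continuous_map_pairedI[OF d1 dY] X] by (simp add: o_def case_prod_unfold)
  have "continuous_map (total_space (subbundle B K'))
      (prod_topology (total_space (subbundle B K)) (total_space (subbundle B (\<lambda>_. UNIV)))) ?g"
    by (intro continuous_map_pairedI continuous_map_into_subbundle d1 dY continuous_map_diff d2 dX)
      (auto simp: Kd)
  then have g: "continuous_map (total_space (subbundle B K')) (total_space ?W) ?g"
    unfolding whitney_sum_def by (auto intro!: continuous_map_into_subtopology)
  show "homeomorphic_maps (total_space ?W) (total_space (subbundle B K')) ?h ?g"
    unfolding homeomorphic_maps_def using h g by (auto simp: top K_eq linear_add[OF linear_Y] YX)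
  fix c and x y :: "('b \<times> 'v) \<times> ('b \<times> 'w)"
  assume x: "x \<in> topspace (total_space ?W)"
  then show "bproj (subbundle B K') (?h x) = bproj ?W x" by (auto simp: whitney_sum_def)
  show "?h (bscale ?W c x) = bscale (subbundle B K') c (?h x)"
    using x by (auto simp: whitney_sum_def algebra_simps linear_cmul[OF linear_X])
  assume y: "y \<in> topspace (total_space ?W)" "bproj ?W x = bproj ?W y"
  show "?h (badd ?W x y) = badd (subbundle B K') (?h x) (?h y)"
    using x y by (auto simp: whitney_sum_def algebra_simps linear_add[OF linear_X])
qed (simp add: whitney_sum_def)

end

text \<open>An element of the pullback over \<open>a\<close> is recovered from its vector
  \<open>v\<close> as \<open>g (\<phi> a, v)\<close>. The maps are kept explicit because the normal
  bundle requires knowing where the tangent vectors of the submanifold are sent.\<close>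

lemma pullback_homeomorphic:
  assumes hg: "homeomorphic_maps (total_space E) (total_space (subbundle B K)) h g"
    and proj: "\<And>x. x \<in> topspace (total_space E) \<Longrightarrow> fst (h x) = bproj E x"
    and \<phi>: "continuous_map A B \<phi>"
  shows "homeomorphic_maps (total_space (pullback_bundle A \<phi> E)) (total_space (subbundle A (K \<circ> \<phi>)))
    (\<lambda>z. (fst z, snd (h (snd z)))) (\<lambda>z. (fst z, g (\<phi> (fst z), snd z)))"
proof -
  note inv = homeomorphic_maps_inverse[OF hg]
  have hK: "bproj E x \<in> topspace B" "snd (h x) \<in> K (bproj E x)" if "x \<in> topspace (total_space E)" for x
    using inv(1)[OF that] proj[OF that] by auto
  have hpair: "h x = (bproj E x, snd (h x))" if "x \<in> topspace (total_space E)" for x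
    using proj[OF that] by (metis prod.collapse)
  have gproj: "bproj E (g (b, v)) = b" if "b \<in> topspace B" "v \<in> K b" for b v
    using proj[of "g (b, v)"] inv(2,4)[of "(b, v)"] that by simp
  have \<phi>B: "\<phi> a \<in> topspace B" if "a \<in> topspace A" for a
    using \<phi> that continuous_map_image_subset_topspace by blast
  let ?P = "pullback_bundle A \<phi> E"
  have top: "topspace (total_space ?P) =
      {(a, x). a \<in> topspace A \<and> x \<in> topspace (total_space E) \<and> \<phi> a = bproj E x}"
    by (auto simp: pullback_bundle_def)
  let ?h = "\<lambda>z. (fst z, snd (h (snd z)))"
  let ?g = "\<lambda>z. (fst z, g (\<phi> (fst z), snd z))"
  have c1: "continuous_map (total_space ?P) A fst"
    and c2: "continuous_map (total_space ?P) (total_space E) snd"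
    by (auto simp: pullback_bundle_def intro: continuous_map_from_subtopology continuous_map_fst continuous_map_snd)
  have hc: "continuous_map (total_space E) (total_space (subbundle B K)) h"
    and gc: "continuous_map (total_space (subbundle B K)) (total_space E) g"
    using hg by (auto simp: homeomorphic_maps_def)
  have "continuous_map (total_space ?P) euclidean (\<lambda>z. snd (h (snd z)))"
    using continuous_map_compose[OF continuous_map_compose[OF c2 hc] continuous_map_subbundle_snd]
    by (simp add: o_def)
  from continuous_map_into_subbundle[OF c1 this, of "K \<circ> \<phi>"]
  have h': "continuous_map (total_space ?P) (total_space (subbundle A (K \<circ> \<phi>))) ?h"
    using hK by (auto simp: top)
  have d1: "continuous_map (total_space (subbundle A (K \<circ> \<phi>))) A fst"
    and d2: "continuous_map (total_space (subbundle A (K \<circ> \<phi>))) euclidean snd"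
    by (rule continuous_map_subbundle_fst continuous_map_subbundle_snd)+
  have "continuous_map (total_space (subbundle A (K \<circ> \<phi>))) B (\<lambda>z. \<phi> (fst z))"
    using continuous_map_compose[OF d1 \<phi>] by (simp add: o_def)
  from continuous_map_into_subbundle[OF this d2, of K]
  have "continuous_map (total_space (subbundle A (K \<circ> \<phi>))) (total_space (subbundle B K))
      (\<lambda>z. (\<phi> (fst z), snd z))" by auto
  from continuous_map_compose[OF this gc]
  have "continuous_map (total_space (subbundle A (K \<circ> \<phi>))) (total_space E) (\<lambda>z. g (\<phi> (fst z), snd z))"
    by (simp add: o_def)
  from continuous_map_pairedI[OF d1 this]
  have g': "continuous_map (total_space (subbundle A (K \<circ> \<phi>))) (total_space ?P) ?g"
    unfolding pullback_bundle_def using gproj \<phi>B by (auto intro!: continuous_map_into_subtopology)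
  have "?g (?h z) = z" if z: "z \<in> topspace (total_space ?P)" for z
  proof -
    have "\<phi> (fst z) = bproj E (snd z)" "snd z \<in> topspace (total_space E)" using z by (auto simp: top)
    then have "(\<phi> (fst z), snd (h (snd z))) = h (snd z)" using hpair by metis
    then show ?thesis using inv(3)[OF \<open>snd z \<in> topspace (total_space E)\<close>] by simp
  qed
  moreover have "?h (?g z) = z" if "z \<in> topspace (total_space (subbundle A (K \<circ> \<phi>)))" for z
    using that inv(4)[of "(\<phi> (fst z), snd z)"] \<phi>B by auto
  ultimately show ?thesis
    unfolding homeomorphic_maps_def using h' g' by blast
qed

lemma fibrewise_closed_pullback:
  assumes "fibrewise_closed E" "\<And>x y. bproj E (badd E x y) = bproj E x" "\<And>c x. bproj E (bscale E c x) = bproj E x"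
  shows "fibrewise_closed (pullback_bundle A \<phi> E)"
  using assms unfolding fibrewise_closed_def by (auto simp: pullback_bundle_def)

text \<open>The first isomorphism theorem for families: by \<open>ker\<close> the cosets are the
  level sets of \<open>\<Theta>\<close>, so \<open>\<Theta>\<close> descends to a bijection. The
  continuous right inverse \<open>\<sigma>\<close>, followed by the coset map, is its inverse and
  makes it a homeomorphism.\<close>

lemma quotient_bundle_isomorphicI:
  assumes base: "base_space E = base_space T"
    and \<Theta>: "continuous_map (total_space E) (total_space T) \<Theta>"
    and \<sigma>: "continuous_map (total_space T) (total_space E) \<sigma>"
    and \<Theta>\<sigma>: "\<And>t. t \<in> topspace (total_space T) \<Longrightarrow> \<Theta> (\<sigma> t) = t"
    and proj: "\<And>x. x \<in> topspace (total_space E) \<Longrightarrow> bproj T (\<Theta> x) = bproj E x"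
    and add: "\<And>x y. x \<in> topspace (total_space E) \<Longrightarrow> y \<in> topspace (total_space E) \<Longrightarrow>
           bproj E x = bproj E y \<Longrightarrow> \<Theta> (badd E x y) = badd T (\<Theta> x) (\<Theta> y)"
    and scale: "\<And>c x. x \<in> topspace (total_space E) \<Longrightarrow> \<Theta> (bscale E c x) = bscale T c (\<Theta> x)"
    and closed: "fibrewise_closed E"
    and ker: "\<And>x. x \<in> topspace (total_space E) \<Longrightarrow>
           bcoset E F j x = {x' \<in> topspace (total_space E). \<Theta> x' = \<Theta> x}"
  shows "quotient_bundle E F j \<cong>\<^sub>b T"
proof -
  let ?q = "bcoset E F j" and ?Q = "quotient_bundle E F j"
  let ?E = "topspace (total_space E)"
  define h where "h A = the_elem (\<Theta> ` A)" for A
  have tot: "total_space ?Q = quotient_topology (total_space E) ?q"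
    by (simp add: quotient_bundle_def)
  have top: "topspace (total_space ?Q) = ?q ` ?E" by (simp add: tot)
  have hq: "h (?q x) = \<Theta> x" if "x \<in> ?E" for x
  proof -
    have "\<Theta> ` ?q x = {\<Theta> x}" using that by (auto simp: ker)
    then show ?thesis by (simp add: h_def)
  qed
  have qeq: "?q x = ?q y \<longleftrightarrow> \<Theta> x = \<Theta> y" if "x \<in> ?E" "y \<in> ?E" for x y
    using that by (auto simp: ker)
  have \<sigma>E: "\<sigma> t \<in> ?E" if "t \<in> topspace (total_space T)" for t
    using \<sigma> that continuous_map_image_subset_topspace by blast
  have \<Theta>T: "\<Theta> x \<in> topspace (total_space T)" if "x \<in> ?E" for x
    using \<Theta> that continuous_map_image_subset_topspace by blast
  have hc: "continuous_map (total_space ?Q) (total_space T) h"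
    unfolding tot
    by (rule continuous_map_from_quotient_topology[OF continuous_map_eq[OF \<Theta>]]) (simp add: hq)
  have gc: "continuous_map (total_space T) (total_space ?Q) (?q \<circ> \<sigma>)"
    unfolding tot by (rule continuous_map_compose[OF \<sigma> continuous_map_to_quotient_topology])
  have homeo: "homeomorphic_maps (total_space ?Q) (total_space T) h (?q \<circ> \<sigma>)"
    unfolding homeomorphic_maps_def top using hc gc
    by (auto simp: hq \<sigma>E \<Theta>\<sigma> \<Theta>T qeq)
  have closedD: "badd E x y \<in> ?E" if "x \<in> ?E" "y \<in> ?E" "bproj E x = bproj E y" for x y
    using closed that unfolding fibrewise_closed_def by blast
  have closedS: "bscale E c x \<in> ?E" if "x \<in> ?E" for c x
    using closed that unfolding fibrewise_closed_def by blast
  have qD: "x' \<in> ?E" "\<Theta> x' = \<Theta> x" "bproj E x' = bproj E x" if "x \<in> ?E" "x' \<in> ?q x" for x x'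
    using that proj[of x] proj[of x'] by (simp_all add: ker)
  have self: "x \<in> ?q x" if "x \<in> ?E" for x using that by (simp add: ker)
  have projq: "bproj ?Q (?q x) = bproj E x" if x: "x \<in> ?E" for x
  proof -
    have "bproj E ` ?q x = {bproj E x}" using qD(3)[OF x] self[OF x] by blast
    then show ?thesis by (simp add: quotient_bundle_def)
  qed
  show ?thesis
  proof (rule bundle_isomorphicI[OF _ homeo])
    show "base_space ?Q = base_space T" by (simp add: quotient_bundle_def base)
    fix c A B assume "A \<in> topspace (total_space ?Q)"
    then obtain x where x: "x \<in> ?E" "A = ?q x" by (auto simp: top)
    show "bproj T (h A) = bproj ?Q A" by (simp add: x hq projq proj)
    have "?q (bscale E c x') = ?q (bscale E c x)" if "x' \<in> ?q x" for x'
      using qD(1,2)[OF x(1) that] x(1) by (simp add: qeq closedS scale)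
    then have "bscale ?Q c A = (\<Union>x'\<in>?q x. ?q (bscale E c x))"
      by (simp add: quotient_bundle_def x)
    \<comment> \<open>All representatives give the same coset, and the union is not empty since
      \<open>x\<close> itself is a representative.\<close>
    also have "\<dots> = ?q (bscale E c x)" using self[OF x(1)] by auto
    finally show "h (bscale ?Q c A) = bscale T c (h A)"
      by (simp add: x hq closedS scale)
    assume "B \<in> topspace (total_space ?Q)" and AB: "bproj ?Q A = bproj ?Q B"
    then obtain y where y: "y \<in> ?E" "B = ?q y" by (auto simp: top)
    have xy: "bproj E x = bproj E y" using AB by (simp add: x y projq)
    have "?q (badd E x' y') = ?q (badd E x y)" if "x' \<in> ?q x" "y' \<in> ?q y" for x' y'
      using qD[OF x(1) that(1)] qD[OF y(1) that(2)] x(1) y(1) xy by (simp add: qeq closedD add)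
    then have "badd ?Q A B = (\<Union>x'\<in>?q x. \<Union>y'\<in>?q y. ?q (badd E x y))"
      by (simp add: quotient_bundle_def x y)
    also have "\<dots> = ?q (badd E x y)" using self[OF x(1)] self[OF y(1)] by auto
    finally show "h (badd ?Q A B) = badd T (h A) (h B)"
      by (simp add: x y hq closedD add xy)
  qed
qed

text \<open>Here \<Theta> is \<open>Y\<close> after \<open>h\<close> and its right inverse is
  \<open>g\<close> after \<open>X\<close>. The hypothesis \<open>jK\<close> says that
  \<open>h\<close> carries the image of \<open>F\<close> onto \<open>K\<close>, the kernel of
  \<open>Y\<close>, which is why cosets are level sets.\<close>

lemma (in subbundle_splitting) quotient_bundle_isomorphic:
  assumes base: "base_space E = B"
    and hg: "homeomorphic_maps (total_space E) (total_space (subbundle B K')) h g"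
    and proj: "\<And>x. x \<in> topspace (total_space E) \<Longrightarrow> fst (h x) = bproj E x"
    and add: "\<And>x y. x \<in> topspace (total_space E) \<Longrightarrow> y \<in> topspace (total_space E) \<Longrightarrow>
           bproj E x = bproj E y \<Longrightarrow> snd (h (badd E x y)) = snd (h x) + snd (h y)"
    and scale: "\<And>c x. x \<in> topspace (total_space E) \<Longrightarrow> snd (h (bscale E c x)) = c *\<^sub>R snd (h x)"
    and bproj_add: "\<And>x y. bproj E (badd E x y) = bproj E x"
    and bproj_scale: "\<And>c x. bproj E (bscale E c x) = bproj E x"
    and closed: "fibrewise_closed E"
    and j: "\<And>y. y \<in> topspace (total_space F) \<Longrightarrow>
           j y \<in> topspace (total_space E) \<and> bproj E (j y) = bproj F y"
    and jK: "\<And>p. p \<in> topspace B \<Longrightarrow>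
           K p = {snd (h (j y)) |y. y \<in> topspace (total_space F) \<and> bproj F y = p}"
  shows "quotient_bundle E F j \<cong>\<^sub>b subbundle B (\<lambda>_. UNIV :: 'w set)"
proof (rule quotient_bundle_isomorphicI)
  let ?E = "topspace (total_space E)" and ?S = "total_space (subbundle B K')"
  let ?\<Theta> = "\<lambda>x. (fst (h x), Y (fst (h x)) (snd (h x)))"
  let ?\<sigma> = "\<lambda>t. g (fst t, X (fst t) (snd t))"
  note inv = homeomorphic_maps_inverse[OF hg]
  have hE: "bproj E x \<in> topspace B" "snd (h x) \<in> K' (bproj E x)" if "x \<in> ?E" for x
    using inv(1)[OF that] proj[OF that] by auto
  have closedD: "badd E x y \<in> ?E" if "x \<in> ?E" "y \<in> ?E" "bproj E x = bproj E y" for x y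
    using closed that unfolding fibrewise_closed_def by blast
  have closedS: "bscale E c x \<in> ?E" if "x \<in> ?E" for c x
    using closed that unfolding fibrewise_closed_def by blast
  have hc: "continuous_map (total_space E) ?S h" and gc: "continuous_map ?S (total_space E) g"
    using hg by (auto simp: homeomorphic_maps_def)
  have h1: "continuous_map (total_space E) B (\<lambda>x. fst (h x))"
    and h2: "continuous_map (total_space E) euclidean (\<lambda>x. snd (h x))"
    using continuous_map_compose[OF hc continuous_map_subbundle_fst]
      continuous_map_compose[OF hc continuous_map_subbundle_snd] by (simp_all add: o_def)
  have "continuous_map (total_space E) euclidean (\<lambda>x. Y (fst (h x)) (snd (h x)))"
    using continuous_map_compose[OF continuous_map_pairedI[OF h1 h2] Y]
    by (simp add: o_def case_prod_unfold)
  then show "continuous_map (total_space E) (total_space (subbundle B (\<lambda>_. UNIV))) ?\<Theta>"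
    by (intro continuous_map_into_subbundle h1) auto
  let ?U = "total_space (subbundle B (\<lambda>_. UNIV :: 'w set))"
  have d1: "continuous_map ?U B fst" and d2: "continuous_map ?U euclidean snd"
    by (rule continuous_map_subbundle_fst continuous_map_subbundle_snd)+
  have "continuous_map ?U euclidean (\<lambda>t. X (fst t) (snd t))"
    using continuous_map_compose[OF continuous_map_pairedI[OF d1 d2] X]
    by (simp add: o_def case_prod_unfold)
  then have "continuous_map ?U ?S (\<lambda>t. (fst t, X (fst t) (snd t)))"
    by (intro continuous_map_into_subbundle d1) (auto simp: X_in)
  from continuous_map_compose[OF this gc]
  show "continuous_map ?U (total_space E) ?\<sigma>" by (simp add: o_def)
  show "?\<Theta> (?\<sigma> t) = t" if "t \<in> topspace ?U" for t
    using that inv(4)[of "(fst t, X (fst t) (snd t))"] by (auto simp: X_in YX)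
  fix x assume x: "x \<in> ?E"
  show "bproj (subbundle B (\<lambda>_. UNIV :: 'w set)) (?\<Theta> x) = bproj E x" by (simp add: proj x)
  show "?\<Theta> (bscale E c x) = bscale (subbundle B (\<lambda>_. UNIV)) c (?\<Theta> x)" for c
    using x by (simp add: proj closedS bproj_scale scale linear_cmul[OF linear_Y])
  show "?\<Theta> (badd E x y) = badd (subbundle B (\<lambda>_. UNIV)) (?\<Theta> x) (?\<Theta> y)"
    if "y \<in> ?E" "bproj E x = bproj E y" for y
    using x that by (simp add: proj closedD bproj_add add linear_add[OF linear_Y])
  show "bcoset E F j x = {x' \<in> ?E. ?\<Theta> x' = ?\<Theta> x}"
  proof (intro equalityI subsetI)
    fix z assume "z \<in> bcoset E F j x"
    then obtain y where y: "y \<in> topspace (total_space F)" "bproj F y = bproj E x" "z = badd E x (j y)"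
      unfolding bcoset_def by blast
    have jy: "j y \<in> ?E" "bproj E x = bproj E (j y)" using j[OF y(1)] y(2) by auto
    have "snd (h (j y)) \<in> K (bproj E x)" unfolding jK[OF hE(1)[OF x]] using y by blast
    then have "Y (bproj E x) (snd (h (j y))) = 0" unfolding K_eq[OF hE(1)[OF x]] by blast
    then show "z \<in> {x' \<in> ?E. ?\<Theta> x' = ?\<Theta> x}"
      using x jy by (simp add: y(3) proj closedD bproj_add add linear_add[OF linear_Y])
  next
    fix z assume "z \<in> {x' \<in> ?E. ?\<Theta> x' = ?\<Theta> x}"
    then have z: "z \<in> ?E" "bproj E z = bproj E x" "Y (bproj E x) (snd (h z)) = Y (bproj E x) (snd (h x))"
      using proj[OF x] proj[of z] by auto
    have "snd (h z) \<in> K' (bproj E x)" using hE(2)[OF z(1)] z(2) by simp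
    then have "snd (h z) - snd (h x) \<in> K' (bproj E x)"
      by (rule subspace_diff[OF subspace[OF hE(1)[OF x]] _ hE(2)[OF x]])
    then have "snd (h z) - snd (h x) \<in> K (bproj E x)"
      using z(3) by (simp add: K_eq[OF hE(1)[OF x]] linear_diff[OF linear_Y])
    then obtain y where y: "y \<in> topspace (total_space F)" "bproj F y = bproj E x"
      "snd (h (j y)) = snd (h z) - snd (h x)"
      unfolding jK[OF hE(1)[OF x]] by force
    have jy: "j y \<in> ?E" "bproj E x = bproj E (j y)" using j[OF y(1)] y(2) by auto
    have "h (badd E x (j y)) = h z"
      using x jy z by (intro prod_eqI) (simp_all add: proj closedD bproj_add add y(3))
    then have "badd E x (j y) = z" using inv(3)[OF z(1)] inv(3)[OF closedD[OF x jy]] by metis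
    then show "z \<in> bcoset E F j x" unfolding bcoset_def using y by blast
  qed
qed (simp_all add: base closed)

text \<open>Replaces sequences of reals by \<open>real^'d\<close>, the space in which the Gram
  operator lives, through an enumeration of the index type.\<close>

lemma trivial_bundle_isomorphic_subbundle:
  assumes "CARD('d) = k"
  shows "trivial_bundle B k \<cong>\<^sub>b subbundle B (\<lambda>_. UNIV :: (real^'d) set)"
proof -
  obtain e :: "nat \<Rightarrow> 'd" where e: "bij_betw e {..<k} UNIV"
    using ex_bij_betw_nat_finite[of "UNIV :: 'd set"] assms by (auto simp: atLeast0LessThan)
  define i where "i = inv_into {..<k} e"
  have i: "i a < k" "e (i a) = a" for a
    using e bij_betwE[OF bij_betw_inv_into[OF e]] bij_betw_inv_into_right[OF e] by (auto simp: i_def)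
  have ie: "i (e l) = l" if "l < k" for l
    using bij_betw_inv_into_left[OF e] that by (simp add: i_def)
  let ?T = "trivial_bundle B k"
  let ?S = "subbundle B (\<lambda>_. UNIV :: (real^'d) set)"
  let ?h = "\<lambda>z :: 'a \<times> (nat \<Rightarrow> real). (fst z, \<chi> a. snd z (i a))"
  \<comment> \<open>\<open>Euclidean_space k\<close> consists of the sequences that vanish from
    index \<open>k\<close> on, hence the value 0 there.\<close>
  let ?g = "\<lambda>z :: 'a \<times> (real^'d). (fst z, \<lambda>l. if l < k then snd z $ e l else 0)"
  have top: "topspace (total_space ?T) = topspace B \<times> {x. \<forall>l\<ge>k. x l = 0}"
    by (simp add: trivial_bundle_def topspace_Euclidean_space)
  have c1: "continuous_map (total_space ?T) B fst"
    and c2: "continuous_map (total_space ?T) (Euclidean_space k) snd"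
    by (auto simp: trivial_bundle_def continuous_map_fst continuous_map_snd)
  have "continuous_map (total_space ?T) (powertop_real UNIV) snd"
    using c2 by (simp add: Euclidean_space_def continuous_map_in_subtopology)
  then have c3: "continuous_map (total_space ?T) euclidean (\<lambda>z. snd z l)" for l
    by (simp add: continuous_map_componentwise_UNIV)
  have "(\<chi> a. snd z (i a)) = (\<Sum>a\<in>UNIV. snd z (i a) *\<^sub>R axis a 1)" for z :: "'a \<times> (nat \<Rightarrow> real)"
    by (simp add: vec_eq_iff axis_def if_distrib sum.delta cong: if_cong)
  moreover have "continuous_map (total_space ?T) euclidean (\<lambda>z. snd z (i a) *\<^sub>R (axis a 1 :: real^'d))" for a
    using continuous_map_compose[OF c3[of "i a"], of euclidean "\<lambda>r. r *\<^sub>R (axis a 1 :: real^'d)"]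
    by (simp add: o_def continuous_on_scaleR)
  ultimately have "continuous_map (total_space ?T) euclidean (\<lambda>z. (\<chi> a. snd z (i a)) :: real^'d)"
    by (simp add: continuous_map_sum)
  then have h: "continuous_map (total_space ?T) (total_space ?S) ?h"
    by (intro continuous_map_into_subbundle c1) auto
  have d1: "continuous_map (total_space ?S) B fst"
    and d2: "continuous_map (total_space ?S) euclidean snd"
    by (rule continuous_map_subbundle_fst continuous_map_subbundle_snd)+
  have "continuous_map (total_space ?S) euclidean (\<lambda>z. snd z $ a)" for a
    using continuous_map_compose[OF d2, of euclidean "\<lambda>v. v $ a"]
    by (simp add: o_def continuous_on_component)
  then have "continuous_map (total_space ?S) (powertop_real UNIV) (\<lambda>z l. if l < k then snd z $ e l else 0)"
    by (simp add: continuous_map_componentwise_UNIV)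
  then have "continuous_map (total_space ?S) (Euclidean_space k) (\<lambda>z l. if l < k then snd z $ e l else 0)"
    by (auto simp: Euclidean_space_def continuous_map_in_subtopology)
  then have g: "continuous_map (total_space ?S) (total_space ?T) ?g"
    unfolding trivial_bundle_def using d1 by (auto intro: continuous_map_pairedI)
  show ?thesis
  proof (rule bundle_isomorphicI)
    show "homeomorphic_maps (total_space ?T) (total_space ?S) ?h ?g"
      unfolding homeomorphic_maps_def using h g by (auto simp: top i ie fun_eq_iff vec_eq_iff)
  qed (auto simp: trivial_bundle_def vec_eq_iff)
qed

section \<open>Quotient manifolds realised in a Euclidean space\<close>

text \<open>A function may have a different continuous formula near each point, as happens when each
  smooth function factors only locally through the embedding.\<close>

lemma continuous_map_locally:
  assumes "\<And>x. x \<in> topspace X \<Longrightarrow>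
    \<exists>U g. openin X U \<and> x \<in> U \<and> continuous_map (subtopology X U) Y g \<and> (\<forall>y\<in>topspace X \<inter> U. f y = g y)"
  shows "continuous_map X Y f"
proof -
  have "\<exists>U. openin X U \<and> x \<in> U \<and> continuous_map (subtopology X U) Y f" if x: "x \<in> topspace X" for x
  proof -
    obtain U g where U: "openin X U" "x \<in> U" "continuous_map (subtopology X U) Y g"
      "\<forall>y\<in>topspace X \<inter> U. f y = g y"
      using assms[OF x] by (elim exE conjE)
    have "continuous_map (subtopology X U) Y f"
      by (rule continuous_map_eq[OF U(3)]) (use U(4) in simp)
    with U(1,2) show ?thesis by blast
  qed
  then obtain U where U: "openin X (U x)" "x \<in> U x" "continuous_map (subtopology X (U x)) Y f"
    if "x \<in> topspace X" for x
    by metis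
  show ?thesis
    by (rule pasting_lemma[where I = "topspace X" and T = U and f = "\<lambda>_. f"]) (use U in auto)
qed

text \<open>The image of the tangent vector \<open>D\<close> under the differential of \<open>\<psi>\<close>.\<close>

definition push :: "('p \<Rightarrow> 'f::euclidean_space) \<Rightarrow> (('p \<Rightarrow> real) \<Rightarrow> real) \<Rightarrow> 'f" where
  "push \<psi> D = (\<Sum>b\<in>Basis. D (\<lambda>p. \<psi> p \<bullet> b) *\<^sub>R b)"

lemma push_add: "push \<psi> (\<lambda>f. D f + D' f) = push \<psi> D + push \<psi> D'"
  by (simp add: push_def scaleR_add_left sum.distrib)

lemma push_scale: "push \<psi> (\<lambda>f. c * D f) = c *\<^sub>R push \<psi> D"
  by (simp add: push_def scaleR_sum_right)

lemma smooth_curve_quotient: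
  assumes "\<And>k. Ck_on k {-e<..<e} c" "c ` {-e<..<e} \<subseteq> X"
  shows "smooth_curve (quotient_manifold X \<pi>) e (\<pi> \<circ> c)"
  unfolding smooth_curve_def
proof (intro conjI ballI)
  show "(\<pi> \<circ> c) ` {-e<..<e} \<subseteq> topspace (mtop (quotient_manifold X \<pi>))"
    using assms(2) by (auto simp: quotient_manifold_def)
  fix f assume "f \<in> smooth_funs (quotient_manifold X \<pi>)"
  then have "smooth_on X (f \<circ> \<pi>)" by (simp add: quotient_manifold_def)
  from smooth_on_compose[OF _ assms this]
  show "smooth_on {-e<..<e} (f \<circ> (\<pi> \<circ> c))" by (simp add: o_def)
qed

text \<open>The map \<open>\<psi> \<circ> \<pi> = P\<close> has local sections up to \<open>\<pi>\<close>, which makes \<open>\<psi>\<close> an embedding of the quotient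
  manifold.\<close>

locale embedded_quotient =
  fixes X :: "'e::euclidean_space set" and \<pi> :: "'e \<Rightarrow> 'p"
    and P :: "'e \<Rightarrow> 'f::euclidean_space" and \<psi> :: "'p \<Rightarrow> 'f"
  assumes smooth_P: "smooth_on X P"
    and \<psi>: "x \<in> X \<Longrightarrow> \<psi> (\<pi> x) = P x"
    and local_section: "q \<in> X \<Longrightarrow> \<exists>W s. open W \<and> P q \<in> W \<and> (\<forall>k. Ck_on k W s) \<and>
           (\<forall>x\<in>X. P x \<in> W \<longrightarrow> s (P x) \<in> X \<and> \<pi> (s (P x)) = \<pi> x)"
begin

abbreviation M :: "'p manifold" where
  "M \<equiv> quotient_manifold X \<pi>"

abbreviation fibre :: "'p \<Rightarrow> 'f set" where
  "fibre p \<equiv> push \<psi> ` tangent_space M p"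

lemma topspace_M: "topspace (mtop M) = \<pi> ` X"
  by (simp add: quotient_manifold_def)

lemma smooth_funs_iff: "f \<in> smooth_funs M \<longleftrightarrow> smooth_on X (f \<circ> \<pi>)"
  by (simp add: quotient_manifold_def)

lemma coordinate_smooth: "(\<lambda>p. \<psi> p \<bullet> b) \<in> smooth_funs M"
proof -
  have "smooth_on X (\<lambda>x. P x \<bullet> b)"
    by (rule smooth_on_bounded_linear[OF bounded_linear_inner_left smooth_P])
  then show ?thesis
    unfolding smooth_funs_iff by (rule smooth_on_cong[THEN iffD1, rotated]) (simp add: \<psi>)
qed

lemma continuous_map_\<psi>: "continuous_map (mtop M) euclidean \<psi>"
proof -
  have "continuous_map (top_of_set X) euclidean P"
    using smooth_on_imp_continuous_on[OF smooth_P] by simp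
  then have "continuous_map (top_of_set X) euclidean (\<psi> \<circ> \<pi>)"
    by (rule continuous_map_eq) (simp add: \<psi>)
  then show ?thesis
    by (simp add: quotient_manifold_def continuous_map_from_quotient_topology)
qed

text \<open>The factor \<phi> is a local section followed by a smooth extension of
  \<open>f \<circ> \<pi>\<close>. The extension is taken near \<open>s (P q)\<close>, which may be a
  different representative of the class of \<open>q\<close>.\<close>

lemma smooth_fun_factors:
  assumes "f \<in> smooth_funs M" "p \<in> \<pi> ` X"
  obtains W \<phi> where "open W" "\<psi> p \<in> W" "\<And>k. Ck_on k W \<phi>"
    "\<And>p'. p' \<in> \<pi> ` X \<Longrightarrow> \<psi> p' \<in> W \<Longrightarrow> \<phi> (\<psi> p') = f p'"
proof -
  obtain q where q: "q \<in> X" "p = \<pi> q" using assms(2) by blast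
  obtain W s where W: "open W" "P q \<in> W" "\<forall>k. Ck_on k W s"
    "\<forall>x\<in>X. P x \<in> W \<longrightarrow> s (P x) \<in> X \<and> \<pi> (s (P x)) = \<pi> x"
    using local_section[OF q(1)] by (elim exE conjE)
  have sq: "s (P q) \<in> X" using W q by blast
  obtain U g where U: "open U" "s (P q) \<in> U" "\<And>k. Ck_on k U g"
    "\<And>y. y \<in> X \<Longrightarrow> y \<in> U \<Longrightarrow> g y = (f \<circ> \<pi>) y"
    by (rule smooth_onE[OF assms(1)[unfolded smooth_funs_iff] sq]) (rule that)
  have op: "open (W \<inter> s -` U)"
    by (rule continuous_open_preimage[OF Ck_on_imp_continuous_on[OF W(3)[rule_format, of 0]] W(1) U(1)])
  show thesis
  proof (rule that[OF op])
    show "\<psi> p \<in> W \<inter> s -` U" using W(2) U(2) q by (simp add: \<psi>)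
    show "Ck_on k (W \<inter> s -` U) (\<lambda>y. g (s y))" for k
      by (rule Ck_on_compose[OF op U(1) _ U(3) Ck_on_subset[OF W(3)[rule_format]]]) auto
    fix p' assume "p' \<in> \<pi> ` X" "\<psi> p' \<in> W \<inter> s -` U"
    then obtain x where x: "x \<in> X" "p' = \<pi> x" "P x \<in> W" "s (P x) \<in> U" by (auto simp: \<psi>)
    then have "s (P x) \<in> X" "\<pi> (s (P x)) = \<pi> x" using W(4) by blast+
    then show "g (s (\<psi> p')) = f p'" using x U(4)[of "s (P x)"] by (simp add: \<psi>)
  qed
qed

text \<open>A curve in the quotient is known only through real-valued smooth functions. The
  coordinates of \<psi> are such functions, so \<open>\<psi> \<circ> \<gamma>\<close> is
  differentiated one coordinate at a time.\<close>

lemma push_velocity: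
  assumes "smooth_curve M e \<gamma>" "e > 0"
  shows "((\<psi> \<circ> \<gamma>) has_vector_derivative push \<psi> (velocity M \<gamma>)) (at 0)"
proof -
  have "((\<lambda>t. \<psi> (\<gamma> t) \<bullet> b) has_vector_derivative velocity M \<gamma> (\<lambda>p. \<psi> p \<bullet> b)) (at 0)" for b
  proof -
    have "smooth_on {-e<..<e} ((\<lambda>p. \<psi> p \<bullet> b) \<circ> \<gamma>)"
      using assms(1) coordinate_smooth unfolding smooth_curve_def by blast
    then have "((\<lambda>p. \<psi> p \<bullet> b) \<circ> \<gamma>) differentiable (at 0)"
      by (rule smooth_on_open_differentiable) (use assms(2) in auto)
    then have "((\<lambda>p. \<psi> p \<bullet> b) \<circ> \<gamma> has_field_derivative deriv ((\<lambda>p. \<psi> p \<bullet> b) \<circ> \<gamma>) 0) (at 0)"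
      using DERIV_deriv_iff_real_differentiable by blast
    then show ?thesis
      using coordinate_smooth[of b] by (simp add: velocity_def o_def has_real_derivative_iff_has_vector_derivative)
  qed
  then have "((\<lambda>t. \<Sum>b\<in>Basis. (\<psi> (\<gamma> t) \<bullet> b) *\<^sub>R b) has_vector_derivative push \<psi> (velocity M \<gamma>)) (at 0)"
    unfolding push_def
    by (intro has_vector_derivative_sum bounded_linear.has_vector_derivative[OF bounded_linear_scaleR_left])
  then show ?thesis by (simp add: o_def euclidean_representation)
qed

lemma tangent_space_subset: "D \<in> tangent_space M p \<Longrightarrow> p \<in> \<pi> ` X"
proof -
  assume "D \<in> tangent_space M p"
  then obtain \<gamma> e where "e > 0" "smooth_curve M e \<gamma>" "\<gamma> 0 = p"
    unfolding tangent_space_def by blast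
  then have "\<gamma> ` {-e<..<e} \<subseteq> \<pi> ` X" "0 \<in> {-e<..<e}"
    unfolding smooth_curve_def topspace_M by auto
  then show ?thesis using \<open>\<gamma> 0 = p\<close> by blast
qed

text \<open>The chain rule for \<open>f \<circ> \<gamma> = \<phi> \<circ> (\<psi> \<circ>
  \<gamma>)\<close>, an equality valid near 0, which is enough for derivatives there. The right-hand
  side sees \<open>D\<close> only through \<open>push \<psi> D\<close>: this gives injectivity of
  \<open>push\<close>, and also continuity of its inverse.\<close>

lemma tangent_vector_eval:
  assumes D: "D \<in> tangent_space M p" and f: "f \<in> smooth_funs M"
    and W: "open W" "\<psi> p \<in> W" "Ck_on (Suc 0) W \<phi>"
    "\<And>p'. p' \<in> \<pi> ` X \<Longrightarrow> \<psi> p' \<in> W \<Longrightarrow> \<phi> (\<psi> p') = f p'"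
  shows "D f = frechet_derivative \<phi> (at (\<psi> p)) (push \<psi> D)"
proof -
  obtain \<gamma> e where \<gamma>: "e > 0" "smooth_curve M e \<gamma>" "\<gamma> 0 = p" "D = velocity M \<gamma>"
    using D unfolding tangent_space_def by blast
  let ?\<eta> = "push \<psi> D" and ?\<phi>' = "frechet_derivative \<phi> (at (\<psi> p))"
  have y: "((\<psi> \<circ> \<gamma>) has_derivative (\<lambda>t. t *\<^sub>R ?\<eta>)) (at 0)"
    using push_velocity[OF \<gamma>(2,1)] by (simp add: \<gamma>(4) has_vector_derivative_def)
  have \<phi>: "(\<phi> has_derivative ?\<phi>') (at ((\<psi> \<circ> \<gamma>) 0))"
    using Ck_on_has_derivative[OF W(3,2)] by (simp add: \<gamma>(3))
  have "(\<phi> \<circ> (\<psi> \<circ> \<gamma>) has_derivative (\<lambda>t. t *\<^sub>R ?\<phi>' ?\<eta>)) (at 0)"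
    using diff_chain_at[OF y \<phi>] by (simp add: o_def linear_cmul[OF has_derivative_linear[OF \<phi>]])
  then have "(\<phi> \<circ> (\<psi> \<circ> \<gamma>) has_real_derivative ?\<phi>' ?\<eta>) (at 0)"
    by (simp add: has_field_derivative_def mult_commute_abs)
  then have "deriv (\<phi> \<circ> (\<psi> \<circ> \<gamma>)) 0 = ?\<phi>' ?\<eta>" by (rule DERIV_imp_deriv)
  moreover have "deriv (f \<circ> \<gamma>) 0 = deriv (\<phi> \<circ> (\<psi> \<circ> \<gamma>)) 0"
  proof (rule deriv_cong_ev)
    have "isCont (\<psi> \<circ> \<gamma>) 0" using has_derivative_continuous[OF y] by simp
    then have "((\<psi> \<circ> \<gamma>) \<longlongrightarrow> (\<psi> \<circ> \<gamma>) 0) (nhds 0)"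
      unfolding isCont_def tendsto_at_iff_tendsto_nhds .
    then have "eventually (\<lambda>t. (\<psi> \<circ> \<gamma>) t \<in> W) (nhds 0)"
      by (rule topological_tendstoD) (use W(1,2) \<gamma>(3) in auto)
    moreover have "eventually (\<lambda>t. t \<in> {-e<..<e}) (nhds 0)"
      by (rule eventually_nhds_in_open) (use \<gamma>(1) in auto)
    ultimately show "eventually (\<lambda>t. (f \<circ> \<gamma>) t = (\<phi> \<circ> (\<psi> \<circ> \<gamma>)) t) (nhds 0)"
    proof eventually_elim
      case (elim t)
      then have "\<gamma> t \<in> \<pi> ` X" using \<gamma>(2) unfolding smooth_curve_def topspace_M by blast
      then show ?case using elim W(4) by simp
    qed
  qed simp
  ultimately show ?thesis using f by (simp add: \<gamma>(4) velocity_def)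
qed

lemma tangent_vector_nonsmooth: "D \<in> tangent_space M p \<Longrightarrow> f \<notin> smooth_funs M \<Longrightarrow> D f = 0"
  by (auto simp: tangent_space_def velocity_def)

text \<open>Tangent spaces are sets of velocities, with no evident addition. A linear relation
  between pushed vectors lifts to the operators because each operator is a linear function of its
  push.\<close>

lemma tangent_vector_combination:
  assumes D: "D \<in> tangent_space M p" "D' \<in> tangent_space M p" "D'' \<in> tangent_space M p"
    and eq: "push \<psi> D'' = a *\<^sub>R push \<psi> D + b *\<^sub>R push \<psi> D'"
  shows "D'' f = a * D f + b * D' f"
proof (cases "f \<in> smooth_funs M")
  case True
  obtain W \<phi> where W: "open W" "\<psi> p \<in> W" "\<And>k. Ck_on k W \<phi>"
    "\<And>p'. p' \<in> \<pi> ` X \<Longrightarrow> \<psi> p' \<in> W \<Longrightarrow> \<phi> (\<psi> p') = f p'"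
    by (rule smooth_fun_factors[OF True tangent_space_subset[OF D(1)]]) (rule that)
  have lin: "linear (frechet_derivative \<phi> (at (\<psi> p)))"
    by (rule has_derivative_linear[OF Ck_on_has_derivative[OF W(3,2)]])
  have ev: "D f = frechet_derivative \<phi> (at (\<psi> p)) (push \<psi> D)" if "D \<in> tangent_space M p" for D
    by (rule tangent_vector_eval[OF that True W])
  show ?thesis
    by (simp add: ev[OF D(1)] ev[OF D(2)] ev[OF D(3)] eq linear_add[OF lin] linear_cmul[OF lin])
next
  case False
  then show ?thesis by (simp add: tangent_vector_nonsmooth[OF D(1)] tangent_vector_nonsmooth[OF D(2)]
        tangent_vector_nonsmooth[OF D(3)])
qed

lemma inj_on_push: "inj_on (push \<psi>) (tangent_space M p)"
proof (rule inj_onI, rule ext)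
  fix D D' f assume "D \<in> tangent_space M p" "D' \<in> tangent_space M p" "push \<psi> D = push \<psi> D'"
  then show "D f = D' f"
    using tangent_vector_combination[of D' p D' D 1 0] by simp
qed

text \<open>Forwards, \<open>push\<close> uses finitely many evaluations \<open>D f\<close>.
  Backwards, the topology demands continuity of \<open>D f\<close> for every \<open>f\<close>; by
  \<open>tangent_vector_eval\<close> it is locally the derivative of \<phi> at
  \<open>\<psi> p\<close> in the direction of the given vector, which is jointly continuous.\<close>

lemma tangent_bundle_homeomorphic:
  "homeomorphic_maps (total_space (tangent_bundle M)) (total_space (subbundle (mtop M) fibre))
     (\<lambda>z. (fst z, push \<psi> (snd z)))
     (\<lambda>z. (fst z, inv_into (tangent_space M (fst z)) (push \<psi>) (snd z)))"
    (is "homeomorphic_maps ?T ?S ?h ?g")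
proof -
  have top: "topspace ?T = {(p, D). p \<in> \<pi> ` X \<and> D \<in> tangent_space M p}"
    by (auto simp: tangent_bundle_def topspace_M)
  have c1: "continuous_map ?T (mtop M) fst"
    by (auto simp: tangent_bundle_def intro: continuous_map_from_subtopology continuous_map_fst)
  have "continuous_map ?T (powertop_real UNIV) snd"
    by (auto simp: tangent_bundle_def intro: continuous_map_from_subtopology continuous_map_snd)
  then have c2: "continuous_map ?T euclidean (\<lambda>z. snd z f)" for f
    by (simp add: continuous_map_componentwise_UNIV)
  have "continuous_map ?T euclidean (\<lambda>z. snd z f *\<^sub>R b)" for f and b :: 'f
    using continuous_map_compose[OF c2[of f], of euclidean "\<lambda>r. r *\<^sub>R b"]
    by (simp add: o_def continuous_on_scaleR)
  then have "continuous_map ?T euclidean (\<lambda>z. push \<psi> (snd z))"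
    unfolding push_def by (intro continuous_map_sum) auto
  then have h: "continuous_map ?T ?S ?h"
    by (intro continuous_map_into_subbundle c1) (auto simp: top)
  let ?i = "\<lambda>z. inv_into (tangent_space M (fst z)) (push \<psi>) (snd z)"
  have i: "?i z \<in> tangent_space M (fst z)" "push \<psi> (?i z) = snd z" if "z \<in> topspace ?S" for z
    using that by (auto simp: inv_into_into f_inv_into_f)
  have d1: "continuous_map ?S (mtop M) fst" and d2: "continuous_map ?S euclidean snd"
    by (rule continuous_map_subbundle_fst continuous_map_subbundle_snd)+
  have d\<psi>: "continuous_map ?S euclidean (\<lambda>z. \<psi> (fst z))"
    using continuous_map_compose[OF d1 continuous_map_\<psi>] by (simp add: o_def)
  have "continuous_map ?S euclidean (\<lambda>z. ?i z f)" for f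
  proof (cases "f \<in> smooth_funs M")
    case True
    show ?thesis
    proof (rule continuous_map_locally)
      fix z assume z: "z \<in> topspace ?S"
      then have "fst z \<in> \<pi> ` X" by (auto simp: topspace_M)
      then obtain W \<phi> where W: "open W" "\<psi> (fst z) \<in> W" "\<And>k. Ck_on k W \<phi>"
        "\<And>p'. p' \<in> \<pi> ` X \<Longrightarrow> \<psi> p' \<in> W \<Longrightarrow> \<phi> (\<psi> p') = f p'"
        by (rule smooth_fun_factors[OF True]) (rule that)
      let ?U = "{y \<in> topspace ?S. \<psi> (fst y) \<in> W}"
      let ?k = "\<lambda>y. frechet_derivative \<phi> (at (\<psi> (fst y))) (snd y)"
      have U: "openin ?S ?U"
        using openin_continuous_map_preimage[OF d\<psi>] W(1) by simp
      have "continuous_map (subtopology ?S ?U) (top_of_set (W \<times> UNIV)) (\<lambda>y. (\<psi> (fst y), snd y))"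
        using continuous_map_pairedI[OF d\<psi> d2]
        by (intro continuous_map_into_subtopology continuous_map_from_subtopology) auto
      moreover have "continuous_map (top_of_set (W \<times> UNIV)) euclidean
          (\<lambda>z. frechet_derivative \<phi> (at (fst z)) (snd z))"
        using continuous_on_frechet_derivative[OF W(3)] by (simp add: case_prod_unfold)
      ultimately have k: "continuous_map (subtopology ?S ?U) euclidean ?k"
        using continuous_map_compose[of "subtopology ?S ?U" "top_of_set (W \<times> UNIV)"
            "\<lambda>y. (\<psi> (fst y), snd y)" euclidean "\<lambda>z. frechet_derivative \<phi> (at (fst z)) (snd z)"]
        unfolding o_def fst_conv snd_conv by blast
      have "?i y f = ?k y" if "y \<in> ?U" for y
        using tangent_vector_eval[OF i(1) True W(1) _ W(3,4)] i(2) that by simp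
      then show "\<exists>U k. openin ?S U \<and> z \<in> U \<and> continuous_map (subtopology ?S U) euclidean k \<and>
          (\<forall>y\<in>topspace ?S \<inter> U. ?i y f = k y)"
        using U W(2) z k by (intro exI[of _ ?U] exI[of _ ?k]) simp
    qed
  next
    case False
    \<comment> \<open>The product topology also has a coordinate for each function that is not
      smooth; there the default value 0 of a velocity is used.\<close>
    have "continuous_map ?S euclidean (\<lambda>z. 0 :: real)" by simp
    then show ?thesis
      by (rule continuous_map_eq) (use tangent_vector_nonsmooth[OF i(1) False] in simp)
  qed
  then have "continuous_map ?S (powertop_real UNIV) ?i"
    by (simp add: continuous_map_componentwise_UNIV)
  then have g: "continuous_map ?S ?T ?g"
    unfolding tangent_bundle_def using d1 i(1)
    by (auto intro!: continuous_map_into_subtopology continuous_map_pairedI)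
  show ?thesis
    unfolding homeomorphic_maps_def using h g
    by (auto simp: top inv_into_f_f[OF inj_on_push] f_inv_into_f)
qed

lemma tangent_bundle_isomorphic: "tangent_bundle M \<cong>\<^sub>b subbundle (mtop M) fibre"
  by (rule bundle_isomorphicI[OF _ tangent_bundle_homeomorphic])
    (auto simp: tangent_bundle_def push_add push_scale)

text \<open>A combination of two velocities has its push in the subspace, so it is the push of some
  velocity, which must be that combination.\<close>

lemma fibrewise_closed_tangent_bundle:
  assumes "\<And>p. p \<in> \<pi> ` X \<Longrightarrow> subspace (fibre p)"
  shows "fibrewise_closed (tangent_bundle M)"
proof -
  have comb: "(\<lambda>f. a * D f + b * D' f) \<in> tangent_space M p"
    if D: "D \<in> tangent_space M p" "D' \<in> tangent_space M p" for a b D D' p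
  proof -
    have "a *\<^sub>R push \<psi> D + b *\<^sub>R push \<psi> D' \<in> fibre p"
      by (intro subspace_add subspace_scale assms tangent_space_subset[OF D(1)]) (use D in auto)
    then obtain D'' where D'': "D'' \<in> tangent_space M p" "push \<psi> D'' = a *\<^sub>R push \<psi> D + b *\<^sub>R push \<psi> D'"
      by auto
    then have "D'' = (\<lambda>f. a * D f + b * D' f)"
      using tangent_vector_combination[OF D D''] by auto
    with D''(1) show ?thesis by simp
  qed
  show ?thesis
    unfolding fibrewise_closed_def
    using comb[where a = 1 and b = 1] comb[where b = 0] by (auto simp: tangent_bundle_def)
qed

lemma fibreI:
  assumes "e > 0" "\<And>k. Ck_on k {-e<..<e} c" "c ` {-e<..<e} \<subseteq> X"
    and "((P \<circ> c) has_vector_derivative \<eta>) (at 0)"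
  shows "\<eta> \<in> fibre (\<pi> (c 0))"
proof -
  have \<gamma>: "smooth_curve M e (\<pi> \<circ> c)" by (rule smooth_curve_quotient[OF assms(2,3)])
  have "((P \<circ> c) has_vector_derivative push \<psi> (velocity M (\<pi> \<circ> c))) (at 0)"
  proof (rule has_vector_derivative_transform_within_open[OF push_velocity[OF \<gamma> assms(1)]])
    show "(\<psi> \<circ> (\<pi> \<circ> c)) t = (P \<circ> c) t" if "t \<in> {-e<..<e}" for t
    proof -
      have "c t \<in> X" using assms(3) that by blast
      then show ?thesis by (simp add: \<psi>)
    qed
  qed (use assms(1) in auto)
  then have "\<eta> = push \<psi> (velocity M (\<pi> \<circ> c))"
    using assms(4) vector_derivative_unique_at by blast
  moreover have "velocity M (\<pi> \<circ> c) \<in> tangent_space M (\<pi> (c 0))"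
    unfolding tangent_space_def using \<gamma> assms(1) by (auto intro!: exI[of _ "\<pi> \<circ> c"])
  ultimately show ?thesis by blast
qed

text \<open>In an open \<open>X\<close> a short straight segment through \<open>q\<close> is an
  admissible curve, so every direction \<open>v\<close> occurs.\<close>

lemma range_subset_fibre:
  assumes X: "open X" "q \<in> X"
  shows "frechet_derivative P (at q) v \<in> fibre (\<pi> q)"
proof -
  define c where "c = (\<lambda>t::real. q + t *\<^sub>R v)"
  have Ck: "Ck_on k S c" if "open S" for k S
    unfolding c_def by (intro Ck_on_add Ck_on_scaleR Ck_on_const Ck_on_ident that)
  have "continuous_on UNIV c" by (rule Ck_on_imp_continuous_on[OF Ck[of _ 0]]) simp
  then have "open (c -` X)" using X(1) open_vimage by blast
  moreover have "0 \<in> c -` X" using X(2) by (simp add: c_def)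
  ultimately obtain e where e: "e > 0" "ball 0 e \<subseteq> c -` X" using open_contains_ball by blast
  have "{-e<..<e} \<subseteq> ball 0 e" by auto
  then have sub: "c ` {-e<..<e} \<subseteq> X" using e(2) by blast
  have "(P has_derivative frechet_derivative P (at q)) (at (c 0))"
    using smooth_on_open_differentiable[OF smooth_P X] by (simp add: c_def frechet_derivative_works)
  moreover have "(c has_derivative (\<lambda>t. t *\<^sub>R v)) (at 0)"
    unfolding c_def by (auto intro!: derivative_eq_intros)
  ultimately have "(P \<circ> c has_derivative frechet_derivative P (at q) \<circ> (\<lambda>t. t *\<^sub>R v)) (at 0)"
    using diff_chain_at by blast
  moreover have "linear (frechet_derivative P (at q))"
    using \<open>(P has_derivative _) _\<close> has_derivative_linear by blast
  ultimately have "(P \<circ> c has_vector_derivative frechet_derivative P (at q) v) (at 0)"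
    by (simp add: has_vector_derivative_def o_def linear_cmul)
  from fibreI[OF e(1) Ck sub this] show ?thesis by (simp add: c_def)
qed

text \<open>A curve in the quotient is lifted by the local section: \<open>P \<circ> s \<circ>
  \<psi> \<circ> \<gamma> = \<psi> \<circ> \<gamma>\<close> near 0, and differentiating puts \<eta>
  in the range of the derivative of \<open>P\<close> at the point chosen by the section. That point
  need not be the given representative, hence the existential form.\<close>

lemma fibre_subset_range:
  assumes X: "open X" and p: "p \<in> \<pi> ` X" and \<eta>: "\<eta> \<in> fibre p"
  obtains q where "q \<in> X" "\<pi> q = p" "\<eta> \<in> range (frechet_derivative P (at q))"
proof -
  obtain q0 where q0: "q0 \<in> X" "p = \<pi> q0" using p by blast
  obtain \<gamma> e where \<gamma>: "e > 0" "smooth_curve M e \<gamma>" "\<gamma> 0 = p" "\<eta> = push \<psi> (velocity M \<gamma>)"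
    using \<eta> unfolding tangent_space_def by blast
  obtain W s where W: "open W" "P q0 \<in> W" "\<forall>k. Ck_on k W s"
    "\<forall>x\<in>X. P x \<in> W \<longrightarrow> s (P x) \<in> X \<and> \<pi> (s (P x)) = \<pi> x"
    using local_section[OF q0(1)] by (elim exE conjE)
  let ?y = "\<psi> \<circ> \<gamma>" and ?q = "s (P q0)"
  have q: "?q \<in> X" "\<pi> ?q = p" using W q0 by auto
  have y0: "?y 0 = P q0" using \<gamma>(3) q0 \<psi> by simp
  have y: "(?y has_derivative (\<lambda>t. t *\<^sub>R \<eta>)) (at 0)"
    using push_velocity[OF \<gamma>(2,1)] by (simp add: \<gamma>(4) has_vector_derivative_def)
  have s: "(s has_derivative frechet_derivative s (at (P q0))) (at (?y 0))"
    unfolding y0 by (rule Ck_on_has_derivative[OF W(3)[rule_format] W(2)])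
  have P: "(P has_derivative frechet_derivative P (at ?q)) (at ((s \<circ> ?y) 0))"
    using smooth_on_open_differentiable[OF smooth_P X q(1)] y0 by (simp add: frechet_derivative_works)
  have Psy: "(P \<circ> (s \<circ> ?y) has_derivative
      frechet_derivative P (at ?q) \<circ> (frechet_derivative s (at (P q0)) \<circ> (\<lambda>t. t *\<^sub>R \<eta>))) (at 0)"
    by (rule diff_chain_at[OF diff_chain_at[OF y s] P])
  have "isCont ?y 0" using has_derivative_continuous[OF y] by simp
  then have "(?y \<longlongrightarrow> ?y 0) (nhds 0)"
    unfolding isCont_def tendsto_at_iff_tendsto_nhds .
  then have "eventually (\<lambda>t. ?y t \<in> W) (nhds 0)"
    by (rule topological_tendstoD) (use W(1,2) y0 in auto)
  moreover have "eventually (\<lambda>t. t \<in> {-e<..<e}) (nhds 0)"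
    by (rule eventually_nhds_in_open) (use \<gamma>(1) in auto)
  ultimately have ev: "eventually (\<lambda>t. (P \<circ> (s \<circ> ?y)) t = ?y t) (nhds 0)"
  proof eventually_elim
    case (elim t)
    then have "\<gamma> t \<in> \<pi> ` X" using \<gamma>(2) unfolding smooth_curve_def topspace_M by blast
    then obtain x where x: "x \<in> X" "\<gamma> t = \<pi> x" by blast
    then have "P x \<in> W" using elim \<psi> by simp
    then have "s (P x) \<in> X" "\<pi> (s (P x)) = \<pi> x" using W(4) x(1) by blast+
    then have "P (s (P x)) = P x" using \<psi> x(1) by metis
    then show ?case using x \<psi> by simp
  qed
  obtain S where S: "open S" "0 \<in> S" "\<forall>t\<in>S. (P \<circ> (s \<circ> ?y)) t = ?y t"
    using ev unfolding eventually_nhds by blast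
  have "(?y has_derivative
      frechet_derivative P (at ?q) \<circ> (frechet_derivative s (at (P q0)) \<circ> (\<lambda>t. t *\<^sub>R \<eta>))) (at 0)"
    by (rule has_derivative_transform_within_open[OF Psy S(1,2)]) (rule S(3)[rule_format])
  \<comment> \<open>Two derivatives of one curve agree as linear maps on the reals; their values at
    1 give the equation.\<close>
  from has_derivative_unique[OF y this]
  have "\<eta> = frechet_derivative P (at ?q) (frechet_derivative s (at (P q0)) \<eta>)"
    by (auto dest!: fun_cong[of _ _ 1])
  then show thesis by (intro that[OF q]) (rule range_eqI)
qed

end

section \<open>The quaternionic Veronese embedding\<close>

lemmas quat_simps = qmult_def vec_eq_iff forall_4 inner_vec_def sum_4 power2_norm_eq_inner

lemma quat_norm_sq: "(norm p)\<^sup>2 = p $ 1 * p $ 1 + p $ 2 * p $ 2 + p $ 3 * p $ 3 + p $ 4 * p $ 4" for p :: quat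
  by (simp add: power2_norm_eq_inner inner_vec_def sum_4)

definition qcnj :: "quat \<Rightarrow> quat" where
  "qcnj p = vector [p$1, - p$2, - p$3, - p$4]"

lemma bounded_bilinear_qmult: "bounded_bilinear (\<odot>)"
proof
  show "(a + a') \<odot> b = a \<odot> b + a' \<odot> b" "a \<odot> (b + b') = a \<odot> b + a \<odot> b'" for a a' b b'
    by (simp_all add: quat_simps algebra_simps)
  show "(r *\<^sub>R a) \<odot> b = r *\<^sub>R (a \<odot> b)" "a \<odot> (r *\<^sub>R b) = r *\<^sub>R (a \<odot> b)" for r a b
    by (simp_all add: quat_simps algebra_simps)
  show "\<exists>K. \<forall>a b. norm (a \<odot> b) \<le> norm a * norm b * K"
    by (rule exI[of _ 1]) (simp add: norm_qmult)
qed

lemma linear_qcnj: "linear qcnj"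
  by (rule linearI) (simp_all add: qcnj_def quat_simps)

lemma norm_qcnj [simp]: "norm (qcnj p) = norm p"
proof -
  have "(norm (qcnj p))\<^sup>2 = (norm p)\<^sup>2" by (simp add: qcnj_def quat_simps)
  then show ?thesis by simp
qed

lemma qcnj_eq_0_iff [simp]: "qcnj p = 0 \<longleftrightarrow> p = 0"
  using norm_qcnj[of p] by (metis norm_eq_zero)

lemma qcnj_qmult: "qcnj (p \<odot> q) = qcnj q \<odot> qcnj p"
  by (simp add: qcnj_def quat_simps algebra_simps)

lemma qcnj_qmult_cancel: "qcnj p \<odot> (p \<odot> q) = (norm p)\<^sup>2 *\<^sub>R q"
  by (simp add: quat_norm_sq qcnj_def qmult_def vec_eq_iff forall_4 algebra_simps)

text \<open>The real part of a Hermitian product is the Euclidean inner product, which is why only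
  component 1 of diagonal entries appears later.\<close>

lemma qcnj_qmult_nth_1: "(qcnj p \<odot> q) $ 1 = p \<bullet> q"
  by (simp add: qcnj_def quat_simps)

lemma qmult_scaleR_left: "(r *\<^sub>R p) \<odot> q = r *\<^sub>R (p \<odot> q)"
  and qmult_scaleR_right: "p \<odot> (r *\<^sub>R q) = r *\<^sub>R (p \<odot> q)"
  using bounded_bilinear.scaleR_left[OF bounded_bilinear_qmult]
    bounded_bilinear.scaleR_right[OF bounded_bilinear_qmult] by blast+

lemma qscale_nth [simp]: "qscale a x $ i = a \<odot> x $ i"
  by (simp add: qscale_def)

lemma qscale_qscale: "qscale a (qscale b x) = qscale (a \<odot> b) x"
  by (simp add: vec_eq_iff[of "qscale _ _"] qmult_assoc)

lemma inner_qmult: "(a \<odot> p) \<bullet> (a \<odot> q) = (norm a)\<^sup>2 * (p \<bullet> q)"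
  by (simp add: quat_norm_sq qmult_def inner_vec_def sum_4 algebra_simps)

lemma inner_qscale: "qscale a x \<bullet> qscale a y = (norm a)\<^sup>2 * (x \<bullet> y)"
  by (simp add: inner_vec_def[of "qscale a x"] inner_vec_def[of x] inner_qmult sum_distrib_left)

lemma qscale_scaleR: "qscale (r *\<^sub>R a) x = r *\<^sub>R qscale a x"
  by (simp add: vec_eq_iff[of _ "_ :: quat^'a"] qmult_scaleR_left)

lemma norm_qscale: "norm (qscale a x) = norm a * norm x"
  by (simp add: norm_eq_sqrt_inner[of "qscale a x"] norm_eq_sqrt_inner[of x] inner_qscale real_sqrt_mult)

definition qinv :: "quat \<Rightarrow> quat" where
  "qinv a = inverse ((norm a)\<^sup>2) *\<^sub>R qcnj a"

lemma norm_qinv: "norm (qinv a) = inverse (norm a)"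
  by (simp add: qinv_def power2_eq_square divide_simps)

lemma qscale_qinv: "a \<noteq> 0 \<Longrightarrow> qscale (qinv a) (qscale a x) = x"
  by (simp add: vec_eq_iff[of "qscale _ _"] qinv_def qmult_scaleR_left qcnj_qmult_cancel)

lemma qscale_one: "qscale (vector [1, 0, 0, 0]) x = x"
  by (simp add: vec_eq_iff[of "qscale _ _"]) (simp add: quat_simps)

lemma norm_quat_one: "norm (vector [1, 0, 0, 0] :: quat) = 1"
  by (simp add: norm_eq_sqrt_inner inner_vec_def sum_4)

lemma self_in_Hstar_orbit: "x \<in> Hstar_orbit x" and self_in_Sp1_orbit: "x \<in> Sp1_orbit x"
  unfolding Hstar_orbit_def Sp1_orbit_def using qscale_one norm_quat_one
  by (metis (mono_tags, lifting) mem_Collect_eq norm_zero zero_neq_one)+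

text \<open>The inclusion \<open>sub\<close>, proved for all nonzero scalars, is used for
  \<open>a\<close> and again for its inverse.\<close>

lemma Hstar_orbit_qscale:
  assumes "a \<noteq> 0"
  shows "Hstar_orbit (qscale a x) = Hstar_orbit x"
proof -
  have sub: "Hstar_orbit (qscale b y) \<subseteq> Hstar_orbit y" if b: "b \<noteq> 0" for b and y :: "quat^'a"
  proof
    fix z assume "z \<in> Hstar_orbit (qscale b y)"
    then obtain c where c: "c \<noteq> 0" "z = qscale (c \<odot> b) y"
      by (auto simp: Hstar_orbit_def qscale_qscale)
    have "c \<odot> b \<noteq> 0" using b c norm_qmult[of c b] by auto
    then show "z \<in> Hstar_orbit y" using c by (auto simp: Hstar_orbit_def)
  qed
  have "qinv a \<noteq> 0" using assms by (simp add: qinv_def)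
  from sub[OF this, of "qscale a x"] show ?thesis
    using sub[OF assms, of x] qscale_qinv[OF assms, of x] by simp
qed

lemma Sp1_orbit_qscale:
  assumes "norm a = 1"
  shows "Sp1_orbit (qscale a x) = Sp1_orbit x"
proof -
  have sub: "Sp1_orbit (qscale b y) \<subseteq> Sp1_orbit y" if b: "norm b = 1" for b and y :: "quat^'a"
  proof
    fix z assume "z \<in> Sp1_orbit (qscale b y)"
    then obtain c where c: "norm c = 1" "z = qscale (c \<odot> b) y"
      by (auto simp: Sp1_orbit_def qscale_qscale)
    have "norm (c \<odot> b) = 1" using b c by (simp add: norm_qmult)
    then show "z \<in> Sp1_orbit y" using c by (auto simp: Sp1_orbit_def)
  qed
  have a: "a \<noteq> 0" using assms by auto
  have "norm (qinv a) = 1" using assms by (simp add: norm_qinv)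
  from sub[OF this, of "qscale a x"] show ?thesis
    using sub[OF assms, of x] qscale_qinv[OF a, of x] by simp
qed

text \<open>The union defining \<open>incl_HP\<close> runs over representatives with equal
  orbits.\<close>

lemma incl_HP_Sp1_orbit: "incl_HP (Sp1_orbit x) = Hstar_orbit x"
proof -
  have "Hstar_orbit (qscale a x) = Hstar_orbit x" if "norm a = 1" for a
    by (rule Hstar_orbit_qscale) (use that in auto)
  then have "Hstar_orbit y = Hstar_orbit x" if "y \<in> Sp1_orbit x" for y
    using that by (auto simp: Sp1_orbit_def)
  then show ?thesis unfolding incl_HP_def using self_in_Sp1_orbit[of x] by blast
qed

section \<open>The Veronese map, its differential and its local sections\<close>

definition hprod :: "quat^'n \<Rightarrow> quat^'n \<Rightarrow> quat^'n^'n" where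
  "hprod x y = (\<chi> i j. qcnj (x $ i) \<odot> y $ j)"

lemma bounded_bilinear_hprod: "bounded_bilinear (hprod :: quat^'n \<Rightarrow> quat^'n \<Rightarrow> quat^'n^'n::finite)"
proof -
  note q = bounded_bilinear_qmult
  have "bilinear (hprod :: quat^'n \<Rightarrow> quat^'n \<Rightarrow> quat^'n^'n)"
    unfolding bilinear_def
    by (auto intro!: linearI simp: hprod_def vec_eq_iff[of _ "_ :: quat^'n^'n"] vec_eq_iff[of _ "_ :: quat^'n"]
        linear_add[OF linear_qcnj] linear_cmul[OF linear_qcnj]
        bounded_bilinear.add_left[OF q] bounded_bilinear.add_right[OF q] qmult_scaleR_left qmult_scaleR_right)
  then show ?thesis using bilinear_conv_bounded_bilinear by blast
qed

text \<open>With the conjugate on the left factor, a left scalar meets its own conjugate in the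
  middle of the product and leaves the real number |a|^2.\<close>

lemma hprod_qscale: "hprod (qscale a x) (qscale a y) = (norm a)\<^sup>2 *\<^sub>R hprod x y"
proof -
  have "qcnj (a \<odot> p) \<odot> (a \<odot> q) = (norm a)\<^sup>2 *\<^sub>R (qcnj p \<odot> q)" for p q
    by (simp add: qcnj_qmult qmult_assoc qcnj_qmult_cancel qmult_scaleR_right)
  then show ?thesis
    by (simp add: hprod_def vec_eq_iff[of _ "_ :: quat^'a^'a"] vec_eq_iff[of _ "_ :: quat^'a"])
qed

text \<open>Acting on row vectors from the right, this is the orthogonal projection onto the left
  quaternionic line of \<open>x\<close>. Dividing by |x|^2 makes it invariant under all nonzero
  scalars, so one map serves both quotients.\<close>

definition veronese :: "quat^'n \<Rightarrow> quat^'n^'n" where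
  "veronese x = inverse (x \<bullet> x) *\<^sub>R hprod x x"

lemma veronese_qscale: "a \<noteq> 0 \<Longrightarrow> veronese (qscale a x) = veronese x"
  by (simp add: veronese_def hprod_qscale inner_qscale)

lemma veronese_row: "veronese x $ i = qscale (inverse (x \<bullet> x) *\<^sub>R qcnj (x $ i)) x"
  by (simp add: veronese_def hprod_def vec_eq_iff[of _ "_ :: quat^'a"] qmult_scaleR_left)

lemma veronese_diag: "veronese x $ i $ i $ 1 = (norm (x $ i))\<^sup>2 / (x \<bullet> x)"
  by (simp add: veronese_def hprod_def qcnj_qmult_nth_1 power2_norm_eq_inner divide_inverse_commute)

text \<open>The differential of \<open>veronese\<close>; the last term comes from the derivative -2
  <x, v> / |x|^4 of 1 / |x|^2.\<close>

definition veronese' :: "quat^'n \<Rightarrow> quat^'n \<Rightarrow> quat^'n^'n" where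
  "veronese' x v = inverse (x \<bullet> x) *\<^sub>R (hprod x v + hprod v x)
     - (2 * (x \<bullet> v) * (inverse (x \<bullet> x))\<^sup>2) *\<^sub>R hprod x x"

lemma has_derivative_veronese:
  assumes "x \<noteq> 0"
  shows "(veronese has_derivative veronese' x) (at x)"
proof -
  have sq: "((\<lambda>y. y \<bullet> y) has_derivative (\<lambda>v. 2 * (x \<bullet> v))) (at x)"
    by (rule has_derivative_eq_rhs[OF has_derivative_inner[OF has_derivative_ident has_derivative_ident]])
      (simp add: inner_commute)
  have inv: "((\<lambda>y. inverse (y \<bullet> y)) has_derivative (\<lambda>v. - (inverse (x \<bullet> x) * (2 * (x \<bullet> v)) * inverse (x \<bullet> x)))) (at x)"
    using assms by (intro Deriv.has_derivative_inverse sq) simp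
  have "((\<lambda>x. hprod x x) has_derivative (\<lambda>v. hprod x v + hprod v x)) (at x)"
    by (rule bounded_bilinear.FDERIV[OF bounded_bilinear_hprod has_derivative_ident has_derivative_ident])
  from has_derivative_scaleR[OF inv this] show ?thesis
    unfolding veronese_def[abs_def]
    by (rule has_derivative_eq_rhs) (auto simp: veronese'_def fun_eq_iff power2_eq_square ac_simps)
qed

lemma frechet_derivative_veronese: "x \<noteq> 0 \<Longrightarrow> frechet_derivative veronese (at x) = veronese' x"
  using frechet_derivative_at[OF has_derivative_veronese] by metis

text \<open>Predicted by differentiating the invariance of \<open>veronese\<close> under
  \<open>qscale a\<close>; the powers of |a|^2 cancel. Hence the range of \<open>veronese'\<close>
  depends only on the orbit.\<close>

lemma veronese'_qscale:
  assumes "a \<noteq> 0"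
  shows "veronese' (qscale a x) (qscale a v) = veronese' x v"
proof -
  define n where "n = (norm a)\<^sup>2"
  have n: "n \<noteq> 0" using assms by (simp add: n_def)
  have "inverse (n * (x \<bullet> x)) * n = inverse (x \<bullet> x)" using n by simp
  moreover have "2 * (n * (x \<bullet> v)) * (inverse (n * (x \<bullet> x)))\<^sup>2 * n = 2 * (x \<bullet> v) * (inverse (x \<bullet> x))\<^sup>2"
    using n by (simp add: power2_eq_square)
  ultimately show ?thesis
    by (simp only: veronese'_def hprod_qscale inner_qscale scaleR_add_right[symmetric] scaleR_scaleR
        n_def[symmetric])
qed

lemma Ck_on_veronese: "Ck_on k (UNIV - {0}) veronese"
proof -
  have op: "open (UNIV - {0 :: quat^'a})" by (simp add: open_delete)
  show ?thesis
    unfolding veronese_def[abs_def]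
    by (intro Ck_on_scaleR Ck_on_inverse Ck_on_inner Ck_on_bilinear[OF _ bounded_bilinear_hprod] Ck_on_ident op) auto
qed

text \<open>Row \<open>i\<close> of \<open>veronese x\<close> has norm |x_i| / |x|, the square root
  of the real part of its diagonal entry, so the quotient is a unit vector in the orbit of
  \<open>x\<close>. Unit length makes the same formula a section for the sphere model of
  \<open>Z_H\<close> and for all nonzero vectors.\<close>

definition vsection :: "'n \<Rightarrow> quat^'n^'n \<Rightarrow> quat^'n" where
  "vsection i y = inverse (sqrt (y $ i $ i $ 1)) *\<^sub>R y $ i"

lemma vsection_veronese:
  assumes "x $ i \<noteq> 0"
  obtains a where "norm a = inverse (norm x)" "vsection i (veronese x) = qscale a x"
proof
  \<comment> \<open>Row \<open>i\<close> is x multiplied by the conjugate of x_i over |x|^2;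
    dividing by |x_i| / |x| leaves this scalar. For a unit vector \<open>x\<close> it lies in
    Sp(1).\<close>
  let ?a = "inverse (norm (x $ i) * norm x) *\<^sub>R qcnj (x $ i)"
  have x: "x \<noteq> 0" using assms by auto
  show "norm ?a = inverse (norm x)" using assms x by (simp add: norm_mult)
  have "inverse (sqrt (veronese x $ i $ i $ 1)) * inverse (x \<bullet> x) = inverse (norm (x $ i) * norm x)"
    using assms x
    by (simp add: veronese_diag real_sqrt_divide norm_eq_sqrt_inner[of x, symmetric] divide_simps)
      (simp add: power2_norm_eq_inner[of x, symmetric] power2_eq_square)
  then show "vsection i (veronese x) = qscale ?a x"
    by (simp only: vsection_def veronese_row qscale_scaleR scaleR_scaleR)
qed

lemma Ck_on_vsection: "Ck_on k {y. y $ i $ i $ 1 > 0} (vsection i)"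
proof -
  let ?W = "{y :: quat^'a^'a. y $ i $ i $ 1 > 0}"
  have op: "open ?W" by (intro open_Collect_less continuous_intros)
  show ?thesis
    unfolding vsection_def[abs_def]
    by (intro Ck_on_scaleR Ck_on_inverse Ck_on_sqrt Ck_on_vec_nth Ck_on_ident op) auto
qed

text \<open>Covers both quotients: the last hypothesis asks that the rescalings of \<open>x\<close>
  to unit length stay in \<open>X\<close> and in the class of \<open>x\<close>, which on
  \<open>Z_H\<close> concerns unit scalars only.\<close>

lemma embedded_quotient_veronese:
  fixes X :: "(quat^'n::finite) set"
  assumes "0 \<notin> X" and orbit: "\<And>x. x \<in> X \<Longrightarrow> the_elem (veronese ` \<pi> x) = veronese x"
    and X: "\<And>a x. x \<in> X \<Longrightarrow> norm a = inverse (norm x) \<Longrightarrow> qscale a x \<in> X \<and> \<pi> (qscale a x) = \<pi> x"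
  shows "embedded_quotient X \<pi> veronese (\<lambda>p. the_elem (veronese ` p))"
proof
  show "smooth_on X veronese"
    by (rule smooth_on_openI[OF _ Ck_on_veronese]) (use assms(1) in \<open>auto simp: open_delete\<close>)
  show "the_elem (veronese ` \<pi> x) = veronese x" if "x \<in> X" for x by (rule orbit[OF that])
  fix q assume q: "q \<in> X"
  then obtain i where i: "q $ i \<noteq> 0" using assms(1) by (metis vec_eq_iff zero_index)
  let ?W = "{y :: quat^'n^'n. y $ i $ i $ 1 > 0}"
  \<comment> \<open>At \<open>x = 0\<close> both sides are false, since 0 / 0 = 0.\<close>
  have W: "veronese x \<in> ?W \<longleftrightarrow> x $ i \<noteq> 0" for x
    by (cases "x = 0") (auto simp: veronese_diag)
  have "vsection i (veronese x) \<in> X \<and> \<pi> (vsection i (veronese x)) = \<pi> x"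
    if x: "x \<in> X" "veronese x \<in> ?W" for x
  proof -
    have "x $ i \<noteq> 0" using W x(2) by blast
    then obtain a where "norm a = inverse (norm x)" "vsection i (veronese x) = qscale a x"
      by (rule vsection_veronese)
    then show ?thesis using X[OF x(1)] by simp
  qed
  then have sec: "\<forall>x\<in>X. veronese x \<in> ?W \<longrightarrow>
      vsection i (veronese x) \<in> X \<and> \<pi> (vsection i (veronese x)) = \<pi> x"
    by blast
  have op: "open ?W" by (intro open_Collect_less continuous_intros)
  have qW: "veronese q \<in> ?W" using W i by blast
  show "\<exists>W s. open W \<and> veronese q \<in> W \<and> (\<forall>k. Ck_on k W s) \<and>
      (\<forall>x\<in>X. veronese x \<in> W \<longrightarrow> s (veronese x) \<in> X \<and> \<pi> (s (veronese x)) = \<pi> x)"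
    by (rule exI[of _ ?W], rule exI[of _ "vsection i"], intro conjI op qW allI Ck_on_vsection sec)
qed

abbreviation orbit_veronese :: "(quat^'n) set \<Rightarrow> quat^'n^'n" where
  "orbit_veronese p \<equiv> the_elem (veronese ` p)"

lemma veronese_Hstar_orbit: "orbit_veronese (Hstar_orbit x) = veronese x"
proof -
  have "veronese ` Hstar_orbit x = {veronese x}"
    using self_in_Hstar_orbit[of x] by (auto simp: Hstar_orbit_def veronese_qscale)
  then show ?thesis by simp
qed

lemma veronese_Sp1_orbit: "orbit_veronese (Sp1_orbit x) = veronese x"
proof -
  have "veronese (qscale a x) = veronese x" if "norm a = 1" for a
    by (rule veronese_qscale) (use that in auto)
  then have "veronese ` Sp1_orbit x = {veronese x}"
    using self_in_Sp1_orbit[of x] by (auto simp: Sp1_orbit_def)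
  then show ?thesis by simp
qed

interpretation HP: embedded_quotient "UNIV - {0}" Hstar_orbit veronese orbit_veronese
  rewrites "quotient_manifold (UNIV - {0}) Hstar_orbit = HP"
proof -
  have "a \<noteq> 0" if "norm a = inverse (norm x)" "x \<noteq> 0" for a :: quat and x :: "quat^'a"
    using that by auto
  moreover have "qscale a x \<noteq> 0" if "a \<noteq> 0" "x \<noteq> 0" for a and x :: "quat^'a"
    using that norm_qscale[of a x] by auto
  ultimately show "embedded_quotient (UNIV - {0 :: quat^'a}) Hstar_orbit veronese orbit_veronese"
    by (intro embedded_quotient_veronese) (auto simp: veronese_Hstar_orbit Hstar_orbit_qscale)
qed (simp add: HP_def)

abbreviation HP_fibre :: "(quat^'n::finite) set \<Rightarrow> (quat^'n^'n) set" where
  "HP_fibre p \<equiv> push orbit_veronese ` tangent_space HP p"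

text \<open>A tangent vector is first found in the range at some representative \<open>q\<close> of
  the orbit; equivariance of \<open>veronese'\<close> moves it to \<open>x\<close>.\<close>

lemma HP_fibre_eq:
  fixes x :: "quat^'n::finite"
  assumes "x \<noteq> 0"
  shows "HP_fibre (Hstar_orbit x) = range (veronese' x)"
proof (intro equalityI subsetI)
  have op: "open (UNIV - {0 :: quat^'n})" by (simp add: open_delete)
  fix \<eta> assume \<eta>: "\<eta> \<in> HP_fibre (Hstar_orbit x)"
  have "Hstar_orbit x \<in> Hstar_orbit ` (UNIV - {0})" using assms by blast
  then obtain q where q: "q \<in> UNIV - {0}" "Hstar_orbit q = Hstar_orbit x"
    "\<eta> \<in> range (frechet_derivative veronese (at q))"
    by (rule HP.fibre_subset_range[OF op _ \<eta>]) (rule that)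
  then obtain v where v: "\<eta> = veronese' q v" using frechet_derivative_veronese[of q] by auto
  have "x \<in> Hstar_orbit q" using q(2) self_in_Hstar_orbit by auto
  then obtain a where "a \<noteq> 0" "x = qscale a q" by (auto simp: Hstar_orbit_def)
  then show "\<eta> \<in> range (veronese' x)"
    unfolding v using veronese'_qscale[of a q v] by (metis rangeI)
next
  have op: "open (UNIV - {0 :: quat^'n})" by (simp add: open_delete)
  fix \<eta> assume "\<eta> \<in> range (veronese' x)"
  then show "\<eta> \<in> HP_fibre (Hstar_orbit x)"
    using HP.range_subset_fibre[OF op, of x] frechet_derivative_veronese[OF assms] assms by auto
qed

lemma linear_veronese': "x \<noteq> 0 \<Longrightarrow> linear (veronese' x)"
  using has_derivative_linear[OF has_derivative_veronese] .

lemma subspace_HP_fibre: "x \<noteq> 0 \<Longrightarrow> subspace (HP_fibre (Hstar_orbit x))"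
  unfolding HP_fibre_eq by (intro linear_subspace_image linear_veronese' subspace_UNIV)

section \<open>The normal directions of an intersection of quadrics\<close>

lemma continuous_on_det:
  fixes A :: "'a::topological_space \<Rightarrow> real^'n^'n"
  assumes "\<And>i j. continuous_on S (\<lambda>x. A x $ i $ j)"
  shows "continuous_on S (\<lambda>x. det (A x))"
  unfolding det_def by (intro continuous_intros assms)

lemma matrix_inv_mult:
  assumes "invertible A"
  shows "A ** matrix_inv A = mat 1" "matrix_inv A ** A = mat 1"
  using someI_ex[OF assms[unfolded invertible_def]] unfolding matrix_inv_def by blast+

text \<open>\<open>matrix_inv\<close> is defined by choice; Cramer's rule, applied to the columns
  A^-1 e_j, exhibits its entries as quotients of determinants.\<close>

lemma continuous_on_matrix_inv: "continuous_on {A :: real^'n^'n. det A \<noteq> 0} matrix_inv"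
proof -
  let ?C = "\<lambda>A :: real^'n^'n. \<chi> k j. det (\<chi> r c. if c = k then axis j 1 $ r else A $ r $ c) / det A"
  have "?C A = matrix_inv A" if "A \<in> {A. det A \<noteq> 0}" for A
  proof -
    have "A *v (matrix_inv A *v axis j 1) = axis j 1" for j
      using that matrix_inv_mult(1)[of A]
      by (simp add: invertible_det_nz matrix_vector_mul_assoc)
    then have "matrix_inv A *v axis j 1 =
        (\<chi> k. det (\<chi> r c. if c = k then axis j 1 $ r else A $ r $ c) / det A)" for j
      using cramer[of A "matrix_inv A *v axis j 1" "axis j 1"] that by simp
    then have "matrix_inv A $ k $ j = det (\<chi> r c. if c = k then axis j 1 $ r else A $ r $ c) / det A" for k j
      by (metis (no_types, lifting) column_def matrix_vector_mult_basis vec_lambda_beta)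
    then show ?thesis by (simp add: vec_eq_iff)
  qed
  moreover have "continuous_on {A. det A \<noteq> 0} ?C"
  proof (intro continuous_on_vec_lambda continuous_on_divide continuous_on_det)
    show "continuous_on {A. det A \<noteq> 0} (\<lambda>A. (\<chi> r c. if c = k then axis j 1 $ r else A $ r $ c) $ r $ c)"
      for k j r c :: 'n
      by (cases "c = k") (auto intro!: continuous_intros)
  qed (auto intro!: continuous_intros)
  ultimately show ?thesis using continuous_on_eq by blast
qed

lemma bproj_tangent_bundle:
  "bproj (tangent_bundle M) (badd (tangent_bundle M) x y) = bproj (tangent_bundle M) x"
    "bproj (tangent_bundle M) (bscale (tangent_bundle M) c x) = bproj (tangent_bundle M) x"
  by (simp_all add: tangent_bundle_def case_prod_unfold)

text \<open>Bundle maps over the quotient are given by formulas in the matrix \<open>f p\<close>, so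
  continuity is checked in Euclidean space. The set \<open>S\<close> admits formulas that are
  continuous only where an operator is invertible.\<close>

lemma continuous_map_compose_left:
  assumes "continuous_map B euclidean f" "f ` topspace B \<subseteq> S" "continuous_on (S \<times> UNIV) (\<lambda>(y, u). g y u)"
  shows "continuous_map (prod_topology B euclidean) euclidean (\<lambda>(p, u). g (f p) u)"
proof -
  have "continuous_map (prod_topology B euclidean) euclidean (\<lambda>z. f (fst z))"
    using continuous_map_compose[OF continuous_map_fst assms(1)] by (simp add: o_def)
  from continuous_map_pairedI[OF this continuous_map_snd]
  have "continuous_map (prod_topology B euclidean) (top_of_set (S \<times> UNIV)) (\<lambda>z. (f (fst z), snd z))"
    by (intro continuous_map_into_subtopology) (use assms(2) in auto)
  moreover have "continuous_map (top_of_set (S \<times> UNIV)) euclidean (\<lambda>(y, u). g y u)"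
    using assms(3) by simp
  ultimately have "continuous_map (prod_topology B euclidean) euclidean
      ((\<lambda>(y, u). g y u) \<circ> (\<lambda>z. (f (fst z), snd z)))"
    by (rule continuous_map_compose)
  then show ?thesis by (simp add: o_def case_prod_unfold)
qed

section \<open>Nondegeneracy and normal fields of an admissible configuration\<close>

locale admissible_configuration =
  fixes \<Lambda> :: "'n::finite \<Rightarrow> real^'d::finite"
  assumes admissible: "admissible \<Lambda>"
begin

lemma Z_H_iff: "q \<in> Z_H \<Lambda> \<longleftrightarrow> (\<Sum>i\<in>UNIV. (norm (q$i))\<^sup>2 *\<^sub>R \<Lambda> i) = 0 \<and> q \<bullet> q = 1"
  by (simp add: Z_H_def inner_vec_def[of q] power2_norm_eq_inner)

lemma zero_notin_Z_H: "0 \<notin> Z_H \<Lambda>"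
  by (simp add: Z_H_iff)

lemma norm_Z_H: "q \<in> Z_H \<Lambda> \<Longrightarrow> norm q = 1"
  by (simp add: Z_H_iff norm_eq_sqrt_inner)

text \<open>By Caratheodory's theorem the \<open>\<Lambda> i\<close> with \<open>q $ i \<noteq> 0\<close> cannot lie in a hyperplane, since then
  0 would be a convex combination of too few of them.\<close>

lemma nondegenerate:
  assumes q: "q \<in> Z_H \<Lambda>" and u: "\<And>i. q $ i \<noteq> 0 \<Longrightarrow> u \<bullet> \<Lambda> i = 0"
  shows "u = 0"
proof (rule ccontr)
  assume "u \<noteq> 0"
  define I where "I = {i. q $ i \<noteq> 0}"
  have "(\<Sum>i\<in>I. (norm (q$i))\<^sup>2 *\<^sub>R \<Lambda> i) = (\<Sum>i\<in>UNIV. (norm (q$i))\<^sup>2 *\<^sub>R \<Lambda> i)"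
    by (rule sum.mono_neutral_left) (auto simp: I_def)
  moreover have "(\<Sum>i\<in>I. (norm (q$i))\<^sup>2) = (\<Sum>i\<in>UNIV. (norm (q$i))\<^sup>2)"
    by (rule sum.mono_neutral_left) (auto simp: I_def)
  moreover have "(\<Sum>i\<in>I. (norm (q$i))\<^sup>2 *\<^sub>R \<Lambda> i) \<in> convex hull (\<Lambda> ` I)" if "(\<Sum>i\<in>I. (norm (q$i))\<^sup>2) = 1"
    by (rule convex_sum[OF _ convex_convex_hull that]) (auto intro: hull_inc)
  ultimately have "0 \<in> convex hull (\<Lambda> ` I)" using q unfolding Z_H_def by simp
  then obtain T where T: "finite T" "T \<subseteq> \<Lambda> ` I" "int (card T) \<le> aff_dim (\<Lambda> ` I) + 1" "0 \<in> convex hull T"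
    unfolding caratheodory_aff_dim[of "\<Lambda> ` I"] by blast
  have "\<Lambda> ` I \<subseteq> {x. u \<bullet> x = 0}" using u by (auto simp: I_def)
  from aff_dim_subset[OF this] have "aff_dim (\<Lambda> ` I) \<le> int (CARD('d)) - 1"
    by (simp add: aff_dim_hyperplane[OF \<open>u \<noteq> 0\<close>] of_nat_diff Suc_le_eq)
  \<comment> \<open>Admissibility counts indices and Caratheodory's theorem counts points. Since
    \<Lambda> may repeat values, one index is chosen for each point of \<open>T\<close>.\<close>
  moreover obtain J where J: "inj_on \<Lambda> J" "T = \<Lambda> ` J"
    using T(2) unfolding subset_image_inj by blast
  moreover have "card J > CARD('d)" using admissible T(4) J(2) unfolding admissible_def by blast
  ultimately show False using T(3) by (simp add: card_image)
qed

text \<open>Extended from the weights |q_i|^2 to all matrices, so that continuity in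
  \<open>y\<close> is immediate. The 2 is the sum \<open>\<Lambda> i + \<Lambda> i\<close> on the
  diagonal of \<open>normal_field\<close>.\<close>

definition gram :: "quat^'n^'n \<Rightarrow> real^'d \<Rightarrow> real^'d" where
  "gram y u = (\<Sum>i\<in>UNIV. (2 * (y $ i $ i $ 1) * (u \<bullet> \<Lambda> i)) *\<^sub>R \<Lambda> i)"

text \<open>In matrix entries the quadratic equations of \<open>Z_H\<close> become linear, so this
  map also describes their derivative.\<close>

definition moment :: "quat^'n^'n \<Rightarrow> real^'d" where
  "moment y = (\<Sum>i\<in>UNIV. (y $ i $ i $ 1) *\<^sub>R \<Lambda> i)"

text \<open>Written in \<open>y\<close> alone, so that no representative of the orbit has to be
  chosen.\<close>

definition normal_field :: "quat^'n^'n \<Rightarrow> real^'d \<Rightarrow> quat^'n^'n" where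
  "normal_field y u = (\<chi> i j. (u \<bullet> (\<Lambda> i + \<Lambda> j)) *\<^sub>R (y $ i $ j))"

lemma linear_gram: "linear (gram y)"
  by (rule linearI)
    (simp_all add: gram_def inner_add_left algebra_simps sum.distrib scaleR_sum_right)

lemma linear_moment: "linear moment"
  by (rule linearI) (simp_all add: moment_def scaleR_add_left sum.distrib scaleR_sum_right)

lemma linear_normal_field: "linear (normal_field y)"
  by (rule linearI) (simp_all add: normal_field_def vec_eq_iff inner_add_left scaleR_add_left algebra_simps)

lemma moment_normal_field: "moment (normal_field y u) = gram y u"
  by (simp add: moment_def normal_field_def gram_def inner_add_right algebra_simps)

lemma diag_Z_H: "q \<in> Z_H \<Lambda> \<Longrightarrow> veronese q $ i $ i $ 1 = (norm (q $ i))\<^sup>2"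
  by (simp add: veronese_diag Z_H_iff)

lemma moment_veronese: "q \<in> Z_H \<Lambda> \<Longrightarrow> moment (veronese q) = 0"
  by (simp add: moment_def diag_Z_H Z_H_iff)

text \<open>The last term of \<open>veronese'\<close> is a multiple of \<open>veronese q\<close>,
  which \<open>moment\<close> kills on \<open>Z_H\<close>; the two mixed terms have equal real
  diagonal parts.\<close>

lemma moment_veronese':
  assumes "q \<in> Z_H \<Lambda>"
  shows "moment (veronese' q v) = 2 *\<^sub>R (\<Sum>i\<in>UNIV. (q $ i \<bullet> v $ i) *\<^sub>R \<Lambda> i)"
proof -
  have q: "q \<bullet> q = 1" using assms by (simp add: Z_H_iff)
  have "veronese q = hprod q q" by (simp add: veronese_def q)
  then have "moment (hprod q q) = 0" using moment_veronese[OF assms] by simp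
  moreover have "moment (hprod q v) = (\<Sum>i\<in>UNIV. (q $ i \<bullet> v $ i) *\<^sub>R \<Lambda> i)" for q v
    by (simp add: moment_def hprod_def qcnj_qmult_nth_1)
  ultimately show ?thesis
    by (simp add: veronese'_def q linear_diff[OF linear_moment] linear_add[OF linear_moment]
        linear_cmul[OF linear_moment] inner_commute scaleR_2)
qed

text \<open>Pairing with \<open>u\<close> gives 2 sum |q_i|^2 <u, \<Lambda>_i>^2. If this vanishes
  then \<open>u\<close> is orthogonal to every \<Lambda>_i with q_i nonzero, and
  \<open>nondegenerate\<close> applies.\<close>

lemma gram_eq_0_iff:
  assumes "q \<in> Z_H \<Lambda>"
  shows "gram (veronese q) u = 0 \<longleftrightarrow> u = 0"
proof
  assume "gram (veronese q) u = 0"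
  then have "0 = u \<bullet> gram (veronese q) u" by simp
  also have "\<dots> = (\<Sum>i\<in>UNIV. 2 * (norm (q $ i))\<^sup>2 * (u \<bullet> \<Lambda> i)\<^sup>2)"
    by (simp add: gram_def inner_sum_right diag_Z_H[OF assms] power2_eq_square mult.assoc)
  finally have "\<forall>i. 2 * (norm (q $ i))\<^sup>2 * (u \<bullet> \<Lambda> i)\<^sup>2 = 0"
    by (subst (asm) eq_commute, subst (asm) sum_nonneg_eq_0_iff) auto
  then show "u = 0" by (intro nondegenerate[OF assms]) auto
qed (simp add: linear_0[OF linear_gram])

lemma inj_gram: "q \<in> Z_H \<Lambda> \<Longrightarrow> inj (gram (veronese q))"
  unfolding linear_injective_0[OF linear_gram] using gram_eq_0_iff by blast

text \<open>Shows that the normal fields are tangent to the projective space. The direction used is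
  orthogonal to \<open>q\<close> by the equations of \<open>Z_H\<close>, so the last term of
  \<open>veronese'\<close> drops out.\<close>

lemma normal_field_eq:
  assumes "q \<in> Z_H \<Lambda>"
  shows "normal_field (veronese q) u = veronese' q (\<chi> i. (u \<bullet> \<Lambda> i) *\<^sub>R q $ i)"
proof -
  have q: "q \<bullet> q = 1" "(\<Sum>i\<in>UNIV. (norm (q$i))\<^sup>2 *\<^sub>R \<Lambda> i) = 0" using assms by (auto simp: Z_H_iff)
  have "q \<bullet> (\<chi> i. (u \<bullet> \<Lambda> i) *\<^sub>R q $ i) = u \<bullet> (\<Sum>i\<in>UNIV. (norm (q$i))\<^sup>2 *\<^sub>R \<Lambda> i)"
    by (simp add: inner_vec_def[of q] inner_sum_right power2_norm_eq_inner mult.commute)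
  then have "q \<bullet> (\<chi> i. (u \<bullet> \<Lambda> i) *\<^sub>R q $ i) = 0" using q(2) by simp
  then show ?thesis
    by (simp add: normal_field_def veronese'_def veronese_def q hprod_def vec_eq_iff[of _ "_ :: quat^'n^'n"]
        vec_eq_iff[of _ "_ :: quat^'n"] qmult_scaleR_left qmult_scaleR_right linear_cmul[OF linear_qcnj]
        inner_add_right scaleR_add_left add.commute)
qed

text \<open>Prescribing \<open>|c\<^sub>i(t)|\<^sup>2\<close> as a quadratic polynomial turns the defining equations of \<open>Z_H \<Lambda>\<close> into a linear
  system for its leading coefficients \<open>|q\<^sub>i|\<^sup>2 s\<^sub>i + |w\<^sub>i|\<^sup>2\<close>.\<close>

lemma curve_in_Z_H:
  assumes q: "q \<in> Z_H \<Lambda>" and v: "(\<Sum>i\<in>UNIV. (q $ i \<bullet> v $ i) *\<^sub>R \<Lambda> i) = 0" "q \<bullet> v = 0"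
  obtains e c where "e > 0" "\<And>k. Ck_on k {-e<..<e} c" "c ` {-e<..<e} \<subseteq> Z_H \<Lambda>" "c 0 = q"
    "(c has_vector_derivative v) (at 0)"
proof -
  \<comment> \<open>The part of v_i along q_i is a_i q_i, and w_i is the orthogonal rest. When q_i =
    0, division by zero gives a_i = 0 and so w_i = v_i.\<close>
  define a where "a i = (q $ i \<bullet> v $ i) / (norm (q $ i))\<^sup>2" for i
  define w where "w i = v $ i - a i *\<^sub>R q $ i" for i
  have aq: "(norm (q $ i))\<^sup>2 * a i = q $ i \<bullet> v $ i" for i
    by (cases "q $ i = 0") (auto simp: a_def)
  have qw: "q $ i \<bullet> w i = 0" for i
  proof -
    have "q $ i \<bullet> w i = q $ i \<bullet> v $ i - a i * (norm (q $ i))\<^sup>2"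
      by (simp add: w_def inner_diff_right power2_norm_eq_inner)
    then show ?thesis using aq[of i] by (simp only: mult.commute[of "a i"] diff_self)
  qed
  define S where "S = (\<Sum>i\<in>UNIV. (norm (w i))\<^sup>2)"
  \<comment> \<open>The vector \<open>u\<close> solves the system for the t^2 coefficients in the
    \<Lambda>-equation; the -2 on the right compensates the factor 2 inside
    \<open>gram\<close>.\<close>
  have "surj (gram (veronese q))"
    by (rule linear_injective_imp_surjective[OF linear_gram inj_gram[OF q]]) simp
  then obtain u where u: "gram (veronese q) u = (- 2) *\<^sub>R (\<Sum>i\<in>UNIV. (norm (w i))\<^sup>2 *\<^sub>R \<Lambda> i)"
    unfolding surj_def by metis
  have Fq: "(\<Sum>i\<in>UNIV. (norm (q$i))\<^sup>2 *\<^sub>R \<Lambda> i) = 0" and nq: "(\<Sum>i\<in>UNIV. (norm (q$i))\<^sup>2) = 1"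
    using q by (auto simp: Z_H_def)
  \<comment> \<open>Subtracting \<open>S\<close> leaves the \<Lambda>-equation intact because sum
    |q_i|^2 \<Lambda>_i = 0, and it makes sum |q_i|^2 s_i equal to -S, which cancels the total of
    the |w_i|^2 in the norm equation.\<close>
  define s where "s i = u \<bullet> \<Lambda> i - S" for i
  have "2 *\<^sub>R (\<Sum>i\<in>UNIV. ((norm (q$i))\<^sup>2 * (u \<bullet> \<Lambda> i)) *\<^sub>R \<Lambda> i) = gram (veronese q) u"
    by (simp add: gram_def diag_Z_H[OF q] scaleR_sum_right mult.assoc)
  then have gu: "(\<Sum>i\<in>UNIV. ((norm (q$i))\<^sup>2 * (u \<bullet> \<Lambda> i)) *\<^sub>R \<Lambda> i) = - (\<Sum>i\<in>UNIV. (norm (w i))\<^sup>2 *\<^sub>R \<Lambda> i)"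
    unfolding u by (metis (no_types, lifting) scaleR_cancel_left scaleR_minus_left scaleR_minus_right zero_neq_numeral)
  have s1: "(\<Sum>i\<in>UNIV. ((norm (q$i))\<^sup>2 * s i) *\<^sub>R \<Lambda> i) = - (\<Sum>i\<in>UNIV. (norm (w i))\<^sup>2 *\<^sub>R \<Lambda> i)"
  proof -
    have "(\<Sum>i\<in>UNIV. ((norm (q$i))\<^sup>2 * s i) *\<^sub>R \<Lambda> i) =
        (\<Sum>i\<in>UNIV. ((norm (q$i))\<^sup>2 * (u \<bullet> \<Lambda> i)) *\<^sub>R \<Lambda> i) - S *\<^sub>R (\<Sum>i\<in>UNIV. (norm (q$i))\<^sup>2 *\<^sub>R \<Lambda> i)"
      by (simp add: s_def algebra_simps scaleR_sum_right sum_subtractf)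
    then show ?thesis using gu Fq by simp
  qed
  have s2: "(\<Sum>i\<in>UNIV. (norm (q$i))\<^sup>2 * s i) = - S"
  proof -
    have "(\<Sum>i\<in>UNIV. (norm (q$i))\<^sup>2 * s i) =
        u \<bullet> (\<Sum>i\<in>UNIV. (norm (q$i))\<^sup>2 *\<^sub>R \<Lambda> i) - S * (\<Sum>i\<in>UNIV. (norm (q$i))\<^sup>2)"
      by (simp add: s_def algebra_simps inner_sum_right sum_distrib_left sum_subtractf)
    then show ?thesis using Fq nq by simp
  qed
  \<comment> \<open>Under the square root g_i contributes g_i |q_i|^2 to |c_i|^2, a polynomial in t.
    The coefficient 2 a_i gives sqrt g_i the derivative a_i at 0, so that c has velocity a_i q_i +
    w_i = v_i.\<close>
  define g where "g i t = 1 + 2 * a i * t + s i * t\<^sup>2" for i t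
  define c where "c t = (\<chi> i. sqrt (g i t) *\<^sub>R q $ i + t *\<^sub>R w i)" for t
  let ?U = "\<Inter>i. {t. g i t > 0}"
  have "open ?U" unfolding g_def by (intro open_INT open_Collect_less continuous_intros finite ballI)
  moreover have "0 \<in> ?U" by (simp add: g_def)
  ultimately obtain e where e: "e > 0" "ball 0 e \<subseteq> ?U" using open_contains_ball by blast
  have pos: "g i t > 0" if "t \<in> {-e<..<e}" for i t
  proof -
    have "t \<in> ball 0 e" using that by auto
    then show ?thesis using e(2) by blast
  qed
  have Ck_g: "Ck_on k {-e<..<e} (g i)" for k i
    unfolding g_def[abs_def] power2_eq_square
    by (intro Ck_on_add Ck_on_mult Ck_on_const Ck_on_ident open_greaterThanLessThan)
  have Ck_c: "Ck_on k {-e<..<e} c" for k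
    unfolding c_def[abs_def]
    by (intro Ck_on_vec_lambda Ck_on_add Ck_on_scaleR Ck_on_const Ck_on_ident Ck_on_sqrt Ck_g
        open_greaterThanLessThan pos)
  have c_norm: "(norm (c t $ i))\<^sup>2 = (norm (q $ i))\<^sup>2 + 2 * t * (q $ i \<bullet> v $ i)
      + t\<^sup>2 * ((norm (q $ i))\<^sup>2 * s i + (norm (w i))\<^sup>2)" if "t \<in> {-e<..<e}" for t i
  proof -
    have "orthogonal (sqrt (g i t) *\<^sub>R q $ i) (t *\<^sub>R w i)"
      by (simp add: orthogonal_def qw)
    then have "(norm (c t $ i))\<^sup>2 = (norm (sqrt (g i t) *\<^sub>R q $ i))\<^sup>2 + (norm (t *\<^sub>R w i))\<^sup>2"
      by (simp only: c_def vec_lambda_beta norm_add_Pythagorean)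
    also have "\<dots> = g i t * (norm (q $ i))\<^sup>2 + t\<^sup>2 * (norm (w i))\<^sup>2"
      using pos[OF that, of i] by (simp add: power_mult_distrib)
    also have "\<dots> = (norm (q $ i))\<^sup>2 + 2 * t * ((norm (q $ i))\<^sup>2 * a i)
      + t\<^sup>2 * ((norm (q $ i))\<^sup>2 * s i + (norm (w i))\<^sup>2)"
      by (simp add: g_def algebra_simps)
    finally show ?thesis unfolding aq .
  qed
  have "c ` {-e<..<e} \<subseteq> Z_H \<Lambda>"
  proof (rule image_subsetI)
    fix t assume t: "t \<in> {-e<..<e}"
    have "(\<Sum>i\<in>UNIV. (norm (c t $ i))\<^sup>2 *\<^sub>R \<Lambda> i) = (\<Sum>i\<in>UNIV. (norm (q$i))\<^sup>2 *\<^sub>R \<Lambda> i)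
        + (2 * t) *\<^sub>R (\<Sum>i\<in>UNIV. (q $ i \<bullet> v $ i) *\<^sub>R \<Lambda> i)
        + t\<^sup>2 *\<^sub>R ((\<Sum>i\<in>UNIV. ((norm (q$i))\<^sup>2 * s i) *\<^sub>R \<Lambda> i) + (\<Sum>i\<in>UNIV. (norm (w i))\<^sup>2 *\<^sub>R \<Lambda> i))"
      by (simp add: c_norm[OF t] scaleR_add_left scaleR_add_right scaleR_sum_right sum.distrib algebra_simps)
    moreover have "(\<Sum>i\<in>UNIV. (norm (c t $ i))\<^sup>2) = (\<Sum>i\<in>UNIV. (norm (q$i))\<^sup>2)
        + (2 * t) * (\<Sum>i\<in>UNIV. q $ i \<bullet> v $ i)
        + t\<^sup>2 * ((\<Sum>i\<in>UNIV. (norm (q$i))\<^sup>2 * s i) + S)"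
      by (simp add: c_norm[OF t] S_def sum_distrib_left sum.distrib algebra_simps)
    moreover have "(\<Sum>i\<in>UNIV. q $ i \<bullet> v $ i) = 0" using v(2) by (simp add: inner_vec_def[of q])
    ultimately show "c t \<in> Z_H \<Lambda>" unfolding Z_H_def using Fq nq v(1) s1 s2 by simp
  qed
  moreover have "c 0 = q" by (simp add: c_def g_def vec_eq_iff[of _ q])
  moreover have "(c has_vector_derivative v) (at 0)"
  proof -
    have g': "(g i has_real_derivative 2 * a i) (at 0)" for i
      unfolding g_def[abs_def] by (auto intro!: derivative_eq_intros)
    have "((\<lambda>t. sqrt (g i t)) has_real_derivative a i) (at 0)" for i
      using DERIV_chain2[OF DERIV_real_sqrt g', of i] by (simp add: g_def)
    then have c1: "((\<lambda>t. sqrt (g i t) *\<^sub>R q $ i) has_vector_derivative a i *\<^sub>R q $ i) (at 0)" for i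
      by (auto intro!: bounded_linear.has_vector_derivative[OF bounded_linear_scaleR_left]
          simp: has_real_derivative_iff_has_vector_derivative)
    have c2: "((\<lambda>t. t *\<^sub>R w i) has_vector_derivative w i) (at 0)" for i
      by (auto intro!: derivative_eq_intros)
    have comp: "((\<lambda>t. c t $ i) has_vector_derivative v $ i) (at 0)" for i
      using has_vector_derivative_add[OF c1 c2, of i i] by (simp add: w_def c_def)
    have "((\<lambda>t. axis i (c t $ i) :: quat^'n) has_vector_derivative axis i (v $ i)) (at 0)" for i
      by (rule bounded_linear.has_vector_derivative[OF bounded_linear_axis comp])
    then have "((\<lambda>t. \<Sum>i\<in>UNIV. axis i (c t $ i) :: quat^'n) has_vector_derivative
        (\<Sum>i\<in>UNIV. axis i (v $ i))) (at 0)"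
      by (rule has_vector_derivative_sum)
    then show ?thesis by (simp only: vec_eq_sum_axis[symmetric] vec_lambda_eta)
  qed
  ultimately show thesis using that[OF e(1) Ck_c] by blast
qed

lemma qscale_Z_H:
  assumes "q \<in> Z_H \<Lambda>" "norm a = 1"
  shows "qscale a q \<in> Z_H \<Lambda>"
  using assms by (simp add: Z_H_def norm_qmult)

section \<open>The tangent spaces of the submanifold inside those of projective space\<close>

sublocale N: embedded_quotient "Z_H \<Lambda>" Sp1_orbit veronese orbit_veronese
  rewrites "quotient_manifold (Z_H \<Lambda>) Sp1_orbit = N_H \<Lambda>"
proof -
  show "embedded_quotient (Z_H \<Lambda>) Sp1_orbit veronese orbit_veronese"
    by (rule embedded_quotient_veronese)
      (simp_all add: zero_notin_Z_H veronese_Sp1_orbit norm_Z_H qscale_Z_H Sp1_orbit_qscale)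
qed (simp add: N_H_def)

abbreviation N_fibre :: "(quat^'n) set \<Rightarrow> (quat^'n^'n) set" where
  "N_fibre p \<equiv> push orbit_veronese ` tangent_space (N_H \<Lambda>) p"

lemma continuous_map_incl_HP: "continuous_map (mtop (N_H \<Lambda>)) (mtop HP) incl_HP"
proof -
  have "continuous_map (top_of_set (Z_H \<Lambda>)) (top_of_set (UNIV - {0})) (\<lambda>x. x)"
    using zero_notin_Z_H by auto
  from continuous_map_compose[OF this continuous_map_to_quotient_topology]
  have "continuous_map (top_of_set (Z_H \<Lambda>)) (mtop HP) (incl_HP \<circ> Sp1_orbit)"
    by (simp add: HP_def quotient_manifold_def o_def incl_HP_Sp1_orbit)
  then show ?thesis
    unfolding N_H_def quotient_manifold_def by (simp add: continuous_map_from_quotient_topology)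
qed

lemma orbit_veronese_incl_HP: "p \<in> Sp1_orbit ` Z_H \<Lambda> \<Longrightarrow> orbit_veronese (incl_HP p) = orbit_veronese p"
  by (auto simp: incl_HP_Sp1_orbit veronese_Hstar_orbit veronese_Sp1_orbit)

text \<open>Smooth functions on \<open>HP\<close> restrict to smooth functions on
  \<open>N_H \<Lambda>\<close>, so a curve remains smooth and the differential is its velocity in
  \<open>HP\<close>. Both pushes differentiate the same curve of matrices: in Euclidean terms the
  inclusion is the identity.\<close>

lemma differential_incl_HP:
  assumes "D \<in> tangent_space (N_H \<Lambda>) p"
  shows "differential HP incl_HP D \<in> tangent_space HP (incl_HP p)"
    and "push orbit_veronese (differential HP incl_HP D) = push orbit_veronese D"
proof -
  obtain \<gamma> e where \<gamma>: "e > 0" "smooth_curve (N_H \<Lambda>) e \<gamma>" "\<gamma> 0 = p" "D = velocity (N_H \<Lambda>) \<gamma>"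
    using assms unfolding tangent_space_def by blast
  have \<gamma>N: "\<gamma> t \<in> Sp1_orbit ` Z_H \<Lambda>" if "t \<in> {-e<..<e}" for t
    using \<gamma>(2) that unfolding smooth_curve_def N.topspace_M by blast
  have pull: "f \<circ> incl_HP \<in> smooth_funs (N_H \<Lambda>)" if "f \<in> smooth_funs HP" for f
  proof -
    have "smooth_on (Z_H \<Lambda>) (f \<circ> Hstar_orbit)"
      using that zero_notin_Z_H unfolding HP.smooth_funs_iff by (rule_tac smooth_on_subset) auto
    then show ?thesis
      unfolding N.smooth_funs_iff by (simp add: o_def incl_HP_Sp1_orbit)
  qed
  have curve: "smooth_curve HP e (incl_HP \<circ> \<gamma>)"
    unfolding smooth_curve_def HP.topspace_M
  proof (intro conjI ballI image_subsetI)
    fix t assume "t \<in> {-e<..<e}"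
    then obtain x where "x \<in> Z_H \<Lambda>" "\<gamma> t = Sp1_orbit x" using \<gamma>N by blast
    then show "(incl_HP \<circ> \<gamma>) t \<in> Hstar_orbit ` (UNIV - {0})"
      using zero_notin_Z_H by (auto simp: incl_HP_Sp1_orbit)
  next
    fix f :: "(quat^'n) set \<Rightarrow> real" assume "f \<in> smooth_funs HP"
    then show "smooth_on {-e<..<e} (f \<circ> (incl_HP \<circ> \<gamma>))"
      using \<gamma>(2) pull unfolding smooth_curve_def by (simp add: o_assoc)
  qed
  have eq: "differential HP incl_HP D = velocity HP (incl_HP \<circ> \<gamma>)"
    by (rule ext) (simp add: differential_def velocity_def \<gamma>(4) pull o_assoc)
  show "differential HP incl_HP D \<in> tangent_space HP (incl_HP p)"
    unfolding eq tangent_space_def using curve \<gamma>(1,3) by (auto intro!: exI[of _ "incl_HP \<circ> \<gamma>"])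
  have "((orbit_veronese \<circ> \<gamma>) has_vector_derivative push orbit_veronese (differential HP incl_HP D)) (at 0)"
  proof (rule has_vector_derivative_transform_within_open)
    show "((orbit_veronese \<circ> (incl_HP \<circ> \<gamma>)) has_vector_derivative
        push orbit_veronese (differential HP incl_HP D)) (at 0)"
      unfolding eq by (rule HP.push_velocity[OF curve \<gamma>(1)])
    show "(orbit_veronese \<circ> (incl_HP \<circ> \<gamma>)) t = (orbit_veronese \<circ> \<gamma>) t" if "t \<in> {-e<..<e}" for t
      using orbit_veronese_incl_HP[OF \<gamma>N[OF that]] by simp
  qed (use \<gamma>(1) in auto)
  moreover have "((orbit_veronese \<circ> \<gamma>) has_vector_derivative push orbit_veronese D) (at 0)"
    unfolding \<gamma>(4) by (rule N.push_velocity[OF \<gamma>(2,1)])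
  ultimately show "push orbit_veronese (differential HP incl_HP D) = push orbit_veronese D"
    by (rule vector_derivative_unique_at)
qed

text \<open>Along a curve in the submanifold the matrix stays in the kernel of the linear map
  \<open>moment\<close>, hence so does its velocity.\<close>

lemma moment_N_fibre:
  assumes "\<eta> \<in> N_fibre p"
  shows "moment \<eta> = 0"
proof -
  obtain \<gamma> e where \<gamma>: "e > 0" "smooth_curve (N_H \<Lambda>) e \<gamma>" "\<eta> = push orbit_veronese (velocity (N_H \<Lambda>) \<gamma>)"
    using assms unfolding tangent_space_def by blast
  have "bounded_linear moment" using linear_moment linear_conv_bounded_linear by blast
  from bounded_linear.has_vector_derivative[OF this N.push_velocity[OF \<gamma>(2,1)]]
  have "((\<lambda>t. moment ((orbit_veronese \<circ> \<gamma>) t)) has_vector_derivative moment \<eta>) (at 0)"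
    unfolding \<gamma>(3) .
  moreover have "((\<lambda>t. moment ((orbit_veronese \<circ> \<gamma>) t)) has_vector_derivative 0) (at 0)"
  proof (rule has_vector_derivative_transform_within_open[OF has_vector_derivative_const])
    fix t assume "t \<in> {-e<..<e}"
    then obtain x where "x \<in> Z_H \<Lambda>" "\<gamma> t = Sp1_orbit x"
      using \<gamma>(2) unfolding smooth_curve_def N.topspace_M by blast
    then show "0 = moment ((orbit_veronese \<circ> \<gamma>) t)"
      by (simp add: veronese_Sp1_orbit moment_veronese)
  qed (use \<gamma>(1) in auto)
  ultimately show ?thesis by (rule vector_derivative_unique_at)
qed

text \<open>For the inclusion from right to left, a direction with vanishing moment is adjusted
  until \<open>curve_in_Z_H\<close> realises it as the velocity of a curve in
  \<open>Z_H\<close>.\<close>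

lemma N_fibre_eq:
  assumes q: "q \<in> Z_H \<Lambda>"
  shows "N_fibre (Sp1_orbit q) = {\<eta> \<in> HP_fibre (Hstar_orbit q). moment \<eta> = 0}"
proof (intro equalityI subsetI)
  fix \<eta> assume \<eta>: "\<eta> \<in> N_fibre (Sp1_orbit q)"
  then obtain D where D: "D \<in> tangent_space (N_H \<Lambda>) (Sp1_orbit q)" "\<eta> = push orbit_veronese D"
    by blast
  then have "\<eta> \<in> HP_fibre (Hstar_orbit q)"
    using differential_incl_HP[OF D(1)] unfolding incl_HP_Sp1_orbit by (metis imageI)
  then show "\<eta> \<in> {\<eta> \<in> HP_fibre (Hstar_orbit q). moment \<eta> = 0}"
    using moment_N_fibre[OF \<eta>] by simp
next
  have q0: "q \<noteq> 0" using q zero_notin_Z_H by auto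
  fix \<eta> assume "\<eta> \<in> {\<eta> \<in> HP_fibre (Hstar_orbit q). moment \<eta> = 0}"
  then obtain v where v: "\<eta> = veronese' q v" "moment \<eta> = 0"
    unfolding HP_fibre_eq[OF q0] by blast
  \<comment> \<open>Removing the radial part makes \<open>v'\<close> tangent to the unit sphere;
    \<eta> does not change because \<open>veronese\<close> is constant along rays.\<close>
  define v' where "v' = v - (q \<bullet> v) *\<^sub>R q"
  have qq: "q \<bullet> q = 1" using q by (simp add: Z_H_iff)
  have "veronese' q q = 0" by (simp add: veronese'_def qq scaleR_2)
  then have \<eta>: "\<eta> = veronese' q v'"
    by (simp add: v(1) v'_def linear_diff[OF linear_veronese'[OF q0]] linear_cmul[OF linear_veronese'[OF q0]])
  have "(\<Sum>i\<in>UNIV. (q $ i \<bullet> v' $ i) *\<^sub>R \<Lambda> i) = 0"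
    using moment_veronese'[OF q, of v'] v(2) by (simp add: \<eta>)
  moreover have "q \<bullet> v' = 0" by (simp add: v'_def inner_diff_right qq)
  ultimately obtain e c where c: "e > 0" "\<And>k. Ck_on k {-e<..<e} c" "c ` {-e<..<e} \<subseteq> Z_H \<Lambda>" "c 0 = q"
    "(c has_vector_derivative v') (at 0)"
    by (rule curve_in_Z_H[OF q]) (rule that)
  have "(veronese has_derivative veronese' q) (at (c 0))"
    unfolding c(4) by (rule has_derivative_veronese[OF q0])
  from diff_chain_at[OF c(5)[unfolded has_vector_derivative_def] this]
  have "((veronese \<circ> c) has_vector_derivative \<eta>) (at 0)"
    by (simp add: has_vector_derivative_def o_def \<eta> linear_cmul[OF linear_veronese'[OF q0]])
  from N.fibreI[OF c(1-3) this] show "\<eta> \<in> N_fibre (Sp1_orbit q)"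
    unfolding c(4) .
qed

section \<open>The splitting and the two bundle isomorphisms\<close>

lemma matrix_gram: "matrix (gram y) *v u = gram y u"
  by (rule matrix_works) (simp add: linear_gram linear_matrix_vector_mul_eq)

lemma continuous_on_normal_field: "continuous_on S (\<lambda>(y, u). normal_field y u)"
  unfolding normal_field_def case_prod_unfold by (intro continuous_intros)

text \<open>Since \<open>moment\<close> of a normal field is \<open>gram\<close>, composing
  \<open>moment\<close> with the inverse Gram matrix gives a left inverse of the normal field map.
  Its kernel in the fibre of \<open>HP\<close> is that of \<open>moment\<close>, which is the fibre
  of \<open>N\<close>.\<close>

lemma splitting:
  "subbundle_splitting (mtop (N_H \<Lambda>)) N_fibre (HP_fibre \<circ> incl_HP)
     (\<lambda>p. normal_field (orbit_veronese p))
     (\<lambda>p \<eta>. matrix_inv (matrix (gram (orbit_veronese p))) *v moment \<eta>)"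
proof (rule subbundle_splitting.intro)
  let ?S = "{y. det (matrix (gram y)) \<noteq> 0}"
  have inv: "invertible (matrix (gram (veronese q)))" if "q \<in> Z_H \<Lambda>" for q
  proof -
    have "inj ((*v) (matrix (gram (veronese q))))"
      using inj_gram[OF that] by (simp add: inj_def matrix_gram)
    then show ?thesis
      using invertible_left_inverse matrix_left_invertible_injective by blast
  qed
  show "continuous_map (prod_topology (mtop (N_H \<Lambda>)) euclidean) euclidean
      (\<lambda>(p, u). normal_field (orbit_veronese p) u)"
    by (rule continuous_map_compose_left[OF N.continuous_map_\<psi> subset_UNIV continuous_on_normal_field])
  have "continuous_on ?S (\<lambda>y. matrix (gram y))"
    unfolding matrix_def gram_def by (intro continuous_intros)
  then have "continuous_on ?S (\<lambda>y. matrix_inv (matrix (gram y)))"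
    by (rule continuous_on_compose2[OF continuous_on_matrix_inv]) auto
  then have "continuous_on (?S \<times> UNIV) (\<lambda>z. matrix_inv (matrix (gram (fst z))) $ i $ j)" for i j
    by (intro continuous_intros continuous_on_compose2[of ?S _ "?S \<times> UNIV" fst]) auto
  moreover have "continuous_on (?S \<times> UNIV) (\<lambda>z. moment (snd z) $ j)" for j
    unfolding moment_def by (intro continuous_intros)
  ultimately have "continuous_on (?S \<times> UNIV) (\<lambda>(y, \<eta>). matrix_inv (matrix (gram y)) *v moment \<eta>)"
    unfolding matrix_vector_mult_def case_prod_unfold
    by (intro continuous_on_vec_lambda continuous_on_sum continuous_on_mult)
  moreover have "orbit_veronese ` topspace (mtop (N_H \<Lambda>)) \<subseteq> ?S"
    using inv unfolding N.topspace_M by (auto simp: veronese_Sp1_orbit invertible_det_nz)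
  ultimately show "continuous_map (prod_topology (mtop (N_H \<Lambda>)) euclidean) euclidean
      (\<lambda>(p, \<eta>). matrix_inv (matrix (gram (orbit_veronese p))) *v moment \<eta>)"
    by (intro continuous_map_compose_left[OF N.continuous_map_\<psi>])
  show "linear (normal_field (orbit_veronese p))" for p by (rule linear_normal_field)
  show "linear (\<lambda>\<eta>. matrix_inv (matrix (gram (orbit_veronese p))) *v moment \<eta>)" for p
    using linear_compose[OF linear_moment matrix_vector_mul_linear] by (simp add: o_def)
  fix p u assume "p \<in> topspace (mtop (N_H \<Lambda>))"
  then obtain q where q: "q \<in> Z_H \<Lambda>" "p = Sp1_orbit q" unfolding N.topspace_M by blast
  have q0: "q \<noteq> 0" using q(1) zero_notin_Z_H by auto
  show "subspace ((HP_fibre \<circ> incl_HP) p)"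
    using subspace_HP_fibre[OF q0] by (simp add: q(2) incl_HP_Sp1_orbit)
  show "normal_field (orbit_veronese p) u \<in> (HP_fibre \<circ> incl_HP) p"
    by (simp add: q(2) incl_HP_Sp1_orbit veronese_Sp1_orbit normal_field_eq[OF q(1)] HP_fibre_eq[OF q0])
  have "matrix_inv (matrix (gram (veronese q))) *v (matrix (gram (veronese q)) *v u) = u" for u
    by (simp add: matrix_vector_mul_assoc matrix_inv_mult(2)[OF inv[OF q(1)]])
  then have cancel: "matrix_inv (matrix (gram (veronese q))) *v gram (veronese q) u = u" for u
    by (simp add: matrix_gram)
  show "matrix_inv (matrix (gram (orbit_veronese p))) *v moment (normal_field (orbit_veronese p) u) = u"
    by (simp add: q(2) veronese_Sp1_orbit moment_normal_field cancel)
  have "matrix_inv (matrix (gram (veronese q))) *v w = 0 \<longleftrightarrow> w = 0" for w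
  proof
    assume "matrix_inv (matrix (gram (veronese q))) *v w = 0"
    then have "(matrix (gram (veronese q)) ** matrix_inv (matrix (gram (veronese q)))) *v w = 0"
      by (simp flip: matrix_vector_mul_assoc)
    then show "w = 0" by (simp add: matrix_inv_mult(1)[OF inv[OF q(1)]])
  qed simp
  then show "N_fibre p = {\<eta> \<in> (HP_fibre \<circ> incl_HP) p.
      matrix_inv (matrix (gram (orbit_veronese p))) *v moment \<eta> = 0}"
    by (simp add: q(2) veronese_Sp1_orbit N_fibre_eq[OF q(1)] incl_HP_Sp1_orbit)
qed

abbreviation (input) ambient_bundle where
  "ambient_bundle \<equiv> pullback_bundle (mtop (N_H \<Lambda>)) incl_HP (tangent_bundle (HP :: (quat^'n) set manifold))"

text \<open>The forward map is stated explicitly so that the image of \<open>T N\<close> under it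
  can be computed.\<close>

lemma ambient_homeomorphic:
  "\<exists>g. homeomorphic_maps (total_space ambient_bundle)
     (total_space (subbundle (mtop (N_H \<Lambda>)) (HP_fibre \<circ> incl_HP)))
     (\<lambda>z. (fst z, push orbit_veronese (snd (snd z)))) g"
  using pullback_homeomorphic[OF HP.tangent_bundle_homeomorphic _ continuous_map_incl_HP]
  by (auto simp: tangent_bundle_def)

lemma fibrewise_closed_ambient: "fibrewise_closed ambient_bundle"
proof (rule fibrewise_closed_pullback)
  show "fibrewise_closed (tangent_bundle (HP :: (quat^'n) set manifold))"
    by (rule HP.fibrewise_closed_tangent_bundle) (use subspace_HP_fibre in blast)
qed (rule bproj_tangent_bundle)+

lemma ambient_isomorphic: "ambient_bundle \<cong>\<^sub>b subbundle (mtop (N_H \<Lambda>)) (HP_fibre \<circ> incl_HP)"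
proof -
  obtain g where g: "homeomorphic_maps (total_space ambient_bundle)
     (total_space (subbundle (mtop (N_H \<Lambda>)) (HP_fibre \<circ> incl_HP)))
     (\<lambda>z. (fst z, push orbit_veronese (snd (snd z)))) g"
    using ambient_homeomorphic ..
  show ?thesis
    by (rule bundle_isomorphicI[OF _ g])
      (auto simp: pullback_bundle_def tangent_bundle_def push_add push_scale)
qed

text \<open>The image of \<open>T N\<close> in the pulled-back tangent bundle corresponds to
  \<open>N_fibre\<close> because \<open>push\<close> is unchanged by the differential of the
  inclusion.\<close>

lemma normal_bundle_isomorphic:
  "normal_bundle (N_H \<Lambda>) HP incl_HP \<cong>\<^sub>b subbundle (mtop (N_H \<Lambda>)) (\<lambda>_. UNIV :: (real^'d) set)"
proof -
  interpret S: subbundle_splitting "mtop (N_H \<Lambda>)" N_fibre "HP_fibre \<circ> incl_HP"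
    "\<lambda>p. normal_field (orbit_veronese p)"
    "\<lambda>p \<eta>. matrix_inv (matrix (gram (orbit_veronese p))) *v moment \<eta>"
    by (rule splitting)
  obtain g where g: "homeomorphic_maps (total_space ambient_bundle)
     (total_space (subbundle (mtop (N_H \<Lambda>)) (HP_fibre \<circ> incl_HP)))
     (\<lambda>z. (fst z, push orbit_veronese (snd (snd z)))) g"
    using ambient_homeomorphic ..
  show ?thesis
    unfolding normal_bundle_def
  proof (rule S.quotient_bundle_isomorphic[OF _ g])
    show "fibrewise_closed ambient_bundle" by (rule fibrewise_closed_ambient)
    fix y assume "y \<in> topspace (total_space (tangent_bundle (N_H \<Lambda>)))"
    then obtain p D where y: "y = (p, D)" "p \<in> topspace (mtop (N_H \<Lambda>))" "D \<in> tangent_space (N_H \<Lambda>) p"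
      by (auto simp: tangent_bundle_def)
    have "incl_HP p \<in> topspace (mtop HP)"
      using continuous_map_incl_HP y(2) continuous_map_image_subset_topspace by blast
    then show "(case y of (p, D) \<Rightarrow> (p, incl_HP p, differential HP incl_HP D)) \<in> topspace (total_space ambient_bundle)
        \<and> bproj ambient_bundle (case y of (p, D) \<Rightarrow> (p, incl_HP p, differential HP incl_HP D)) =
          bproj (tangent_bundle (N_H \<Lambda>)) y"
      using y differential_incl_HP(1)[OF y(3)] by (simp add: pullback_bundle_def tangent_bundle_def)
  next
    fix p assume p: "p \<in> topspace (mtop (N_H \<Lambda>))"
    have "N_fibre p = {push orbit_veronese (differential HP incl_HP D) |D. D \<in> tangent_space (N_H \<Lambda>) p}"
      using differential_incl_HP(2) by (force simp: image_iff)
    then show "N_fibre p = {snd (fst (case y of (p, D) \<Rightarrow> (p, incl_HP p, differential HP incl_HP D)),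
          push orbit_veronese (snd (snd (case y of (p, D) \<Rightarrow> (p, incl_HP p, differential HP incl_HP D))))) |y.
        y \<in> topspace (total_space (tangent_bundle (N_H \<Lambda>))) \<and> bproj (tangent_bundle (N_H \<Lambda>)) y = p}"
      using p by (auto simp: tangent_bundle_def)
  qed (auto simp: pullback_bundle_def tangent_bundle_def push_add push_scale)
qed

text \<open>Both summands are moved into Euclidean space, added there by the splitting, and the sum
  is carried back to the pullback.\<close>

lemma tangent_bundle_sum_isomorphic:
  "tangent_bundle (N_H \<Lambda>) \<oplus>\<^sub>b trivial_bundle (mtop (N_H \<Lambda>)) CARD('d) \<cong>\<^sub>b ambient_bundle"
proof -
  interpret S: subbundle_splitting "mtop (N_H \<Lambda>)" N_fibre "HP_fibre \<circ> incl_HP"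
    "\<lambda>p. normal_field (orbit_veronese p)"
    "\<lambda>p \<eta>. matrix_inv (matrix (gram (orbit_veronese p))) *v moment \<eta>"
    by (rule splitting)
  show ?thesis
    by (rule bundle_isomorphic_trans[OF
          whitney_sum_cong[OF N.tangent_bundle_isomorphic trivial_bundle_isomorphic_subbundle[OF refl]]
          bundle_isomorphic_trans[OF S.whitney_sum_isomorphic
            bundle_isomorphic_sym[OF ambient_isomorphic fibrewise_closed_ambient]]])
qed

end

theorem proposition9p1:
  fixes m :: nat and \<Lambda> :: "'n::finite \<Rightarrow> real^'d"
  assumes "m \<ge> 1" and "CARD('d) = 4 * m"
    and "admissible \<Lambda>"
    and "affine hull (range \<Lambda>) = UNIV"
  shows "is_trivial_bundle (normal_bundle (N_H \<Lambda>) (HP :: (quat^'n) set manifold) incl_HP)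
    \<and> tangent_bundle (N_H \<Lambda>) \<oplus>\<^sub>b trivial_bundle (mtop (N_H \<Lambda>)) (4 * m)
        \<cong>\<^sub>b pullback_bundle (mtop (N_H \<Lambda>)) incl_HP (tangent_bundle (HP :: (quat^'n) set manifold))"
proof -
  interpret admissible_configuration \<Lambda> by unfold_locales (rule assms(3))
  \<comment> \<open>Allows the isomorphism from the trivial bundle to the constant family to be
    reversed.\<close>
  have "fibrewise_closed (trivial_bundle (mtop (N_H \<Lambda>)) (4 * m))"
    by (auto simp: fibrewise_closed_def trivial_bundle_def topspace_Euclidean_space)
  from bundle_isomorphic_trans[OF normal_bundle_isomorphic
      bundle_isomorphic_sym[OF trivial_bundle_isomorphic_subbundle[OF assms(2)] this]]
  have "normal_bundle (N_H \<Lambda>) HP incl_HP \<cong>\<^sub>b trivial_bundle (mtop (N_H \<Lambda>)) (4 * m)" .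
  moreover have "base_space (normal_bundle (N_H \<Lambda>) HP incl_HP) = mtop (N_H \<Lambda>)"
    by (simp add: normal_bundle_def quotient_bundle_def pullback_bundle_def)
  ultimately have "is_trivial_bundle (normal_bundle (N_H \<Lambda>) HP incl_HP)"
    unfolding is_trivial_bundle_def by auto
  then show ?thesis using tangent_bundle_sum_isomorphic unfolding assms(2) by blast
qed

end
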